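(* Let $(R,\mathfrak m,k)$ be a Cohen-Macaulay local ring of dimension $d$ with infinite residue field $k$, $I$ an $\mathfrak m$-primary ideal, $\mathfrak F=\{I_n\}_{n\in\mathbb Z}$ an admissible $I$-filtration and $J$ a minimal reduction of $I$ such that $J\cap I_k=JI_{k-1}$ for $1\le k\le n$ (i.e. $\mathfrak F$ is $n$-standard with respect to $J$). Then for $0\le k\le n$, $$\lambda(I_{k+1}/JI_k)=e_0(I)+\sum_{i=0}^{k}(-1)^{i+1}\binom{d-1}{i}\lambda_{\mathfrak F}(k-i),$$ where $\lambda_{\mathfrak F}(j)=\lambda(I_j/I_{j+1})$.
   Context: $\lambda$ denotes length, $e_0(I)$ the Hilbert–Samuel multiplicity of $I$. An admissible $I$-filtration is a family of ideals $\{I_n\}_{n\in\mathbb Z}$ with $I_{n+1}\subseteq I_n$, $I_n=R$ for $n\le 0$, $I_nI_m\subseteq I_{n+m}$, and some $c\ge0$ with $I^n\subseteq I_n\subseteq I^{n-c}$ for all $n\ge0$. A minimal reduction of $I$ is an ideal $J\subseteq I$ generated by $d$ elements with $JI^m=I^{m+1}$ for some $m$. *)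

theory Defs
  imports Complex_Main
begin

definition is_ideal :: "'a::comm_ring_1 set \<Rightarrow> bool" where
  "is_ideal I \<longleftrightarrow> 0 \<in> I \<and> (\<forall>a\<in>I. \<forall>b\<in>I. a + b \<in> I) \<and> (\<forall>r. \<forall>a\<in>I. r * a \<in> I)"

definition gen_ideal :: "'a::comm_ring_1 set \<Rightarrow> 'a set" where
  "gen_ideal S = \<Inter>{I. is_ideal I \<and> S \<subseteq> I}"

definition ideal_prod :: "'a::comm_ring_1 set \<Rightarrow> 'a set \<Rightarrow> 'a set" where
  "ideal_prod I J = gen_ideal {a * b | a b. a \<in> I \<and> b \<in> J}"

primrec ideal_pow :: "'a::comm_ring_1 set \<Rightarrow> nat \<Rightarrow> 'a set" where
  "ideal_pow I 0 = UNIV"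
| "ideal_pow I (Suc n) = ideal_prod I (ideal_pow I n)"

definition radical :: "'a::comm_ring_1 set \<Rightarrow> 'a set" where
  "radical I = {x. \<exists>n. x ^ n \<in> I}"

definition is_prime_ideal :: "'a::comm_ring_1 set \<Rightarrow> bool" where
  "is_prime_ideal P \<longleftrightarrow> is_ideal P \<and> P \<noteq> UNIV \<and> (\<forall>a b. a * b \<in> P \<longrightarrow> a \<in> P \<or> b \<in> P)"

definition is_maximal_ideal :: "'a::comm_ring_1 set \<Rightarrow> bool" where
  "is_maximal_ideal M \<longleftrightarrow> is_ideal M \<and> M \<noteq> UNIV \<and>
     (\<forall>I. is_ideal I \<and> M \<subseteq> I \<longrightarrow> I = M \<or> I = UNIV)"

definition noetherian_ring :: "'a::comm_ring_1 itself \<Rightarrow> bool" where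
  "noetherian_ring _ \<longleftrightarrow> (\<forall>f :: nat \<Rightarrow> 'a set. (\<forall>n. is_ideal (f n)) \<and> (\<forall>n. f n \<subseteq> f (Suc n))
      \<longrightarrow> (\<exists>N. \<forall>n\<ge>N. f n = f N))"

definition local_ring :: "'a::comm_ring_1 set \<Rightarrow> bool" where
  "local_ring m \<longleftrightarrow> noetherian_ring TYPE('a) \<and> is_maximal_ideal m \<and>
     (\<forall>M. is_maximal_ideal M \<longrightarrow> M = m)"

definition prime_chain :: "nat \<Rightarrow> (nat \<Rightarrow> 'a::comm_ring_1 set) \<Rightarrow> bool" where
  "prime_chain n P \<longleftrightarrow> (\<forall>i\<le>n. is_prime_ideal (P i)) \<and> (\<forall>i<n. P i \<subset> P (Suc i))"

definition krull_dim_eq :: "'a::comm_ring_1 itself \<Rightarrow> nat \<Rightarrow> bool" where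
  "krull_dim_eq _ d \<longleftrightarrow> (\<exists>P :: nat \<Rightarrow> 'a set. prime_chain d P) \<and>
     \<not> (\<exists>P :: nat \<Rightarrow> 'a set. prime_chain (Suc d) P)"

definition regular_sequence :: "'a::comm_ring_1 set \<Rightarrow> 'a list \<Rightarrow> bool" where
  "regular_sequence m xs \<longleftrightarrow> set xs \<subseteq> m \<and> gen_ideal (set xs) \<noteq> UNIV \<and>
     (\<forall>i<length xs. \<forall>r. xs ! i * r \<in> gen_ideal (set (take i xs)) \<longrightarrow> r \<in> gen_ideal (set (take i xs)))"

definition depth_eq :: "'a::comm_ring_1 set \<Rightarrow> nat \<Rightarrow> bool" where
  "depth_eq m d \<longleftrightarrow> (\<exists>xs. length xs = d \<and> regular_sequence m xs) \<and>
     \<not> (\<exists>xs. length xs = Suc d \<and> regular_sequence m xs)"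

definition cm_local_ring :: "'a::comm_ring_1 set \<Rightarrow> nat \<Rightarrow> bool" where
  "cm_local_ring m d \<longleftrightarrow> local_ring m \<and> krull_dim_eq TYPE('a) d \<and> depth_eq m d"

text \<open>Length lambda(M/N) of the R-module M/N for ideals N \<subseteq> M: the maximal length of a
  strict chain of submodules (= ideals) N = C_0 < C_1 < ... < C_n = M.\<close>
definition ideal_chain :: "'a::comm_ring_1 set \<Rightarrow> 'a set \<Rightarrow> nat \<Rightarrow> bool" where
  "ideal_chain M N n \<longleftrightarrow> (\<exists>C :: nat \<Rightarrow> 'a set. C 0 = N \<and> C n = M \<and>
      (\<forall>i\<le>n. is_ideal (C i)) \<and> (\<forall>i<n. C i \<subset> C (Suc i)))"

definition qlength :: "'a::comm_ring_1 set \<Rightarrow> 'a set \<Rightarrow> nat" where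
  "qlength M N = (GREATEST n. ideal_chain M N n)"

definition m_primary :: "'a::comm_ring_1 set \<Rightarrow> 'a set \<Rightarrow> bool" where
  "m_primary m I \<longleftrightarrow> is_ideal I \<and> radical I = m"

text \<open>Hilbert-Samuel multiplicity e_0(I) in a ring of dimension d: the leading coefficient
  of the Hilbert-Samuel polynomial,
  lambda(R/I^(n+1)) = sum_{i=0}^d (-1)^i e_i binom(n+d-i, d-i) for n >> 0.\<close>
definition hs_mult :: "'a::comm_ring_1 set \<Rightarrow> nat \<Rightarrow> int" where
  "hs_mult I d = (THE e. \<exists>es :: nat \<Rightarrow> int. es 0 = e \<and>
     (\<exists>N. \<forall>n\<ge>N. int (qlength UNIV (ideal_pow I (Suc n))) =
          (\<Sum>i=0..d. (-1) ^ i * es i * int ((n + d - i) choose (d - i)))))"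

definition admissible_filtration :: "'a::comm_ring_1 set \<Rightarrow> (int \<Rightarrow> 'a set) \<Rightarrow> bool" where
  "admissible_filtration I F \<longleftrightarrow> (\<forall>n. is_ideal (F n)) \<and> (\<forall>n. F (n + 1) \<subseteq> F n) \<and>
     (\<forall>n\<le>0. F n = UNIV) \<and> (\<forall>n m. ideal_prod (F n) (F m) \<subseteq> F (n + m)) \<and>
     (\<exists>c::int\<ge>0. \<forall>n\<ge>0. ideal_pow I (nat n) \<subseteq> F n \<and> F n \<subseteq> ideal_pow I (nat (n - c)))"

definition minimal_reduction :: "nat \<Rightarrow> 'a::comm_ring_1 set \<Rightarrow> 'a set \<Rightarrow> bool" where
  "minimal_reduction d J I \<longleftrightarrow> J \<subseteq> I \<and> (\<exists>xs. length xs = d \<and> J = gen_ideal (set xs)) \<and>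
     (\<exists>k. ideal_prod J (ideal_pow I k) = ideal_pow I (Suc k))"

definition infinite_residue_field :: "'a::comm_ring_1 set \<Rightarrow> bool" where
  "infinite_residue_field m \<longleftrightarrow> infinite (range (\<lambda>x. {y. x - y \<in> m}))"

end

theory Submission
  imports Defs
begin

text \<open>Since \<open>R\<close> is Cohen-Macaulay, \<open>J\<close> has generators \<open>x\<^sub>1, \<dots>, x\<^sub>d\<close> forming a regular sequence.
  By the argument of Valabrega and Valla, being \<open>n\<close>-standard passes to \<open>(x\<^sub>1, \<dots>, x\<^sub>j)\<close>; hence for
  \<open>k \<le> n\<close> the function \<open>\<lambda>(R/((x\<^sub>1, \<dots>, x\<^sub>j) + I\<^sub>k))\<close> is the \<open>j\<close>-th backward difference of
  \<open>L(k) = \<lambda>(R/I\<^sub>k)\<close>. Filtering \<open>J/J I\<^sub>k\<close> by the generators shows that its length is the sum of these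
  differences over \<open>j < d\<close>, which telescopes to \<open>L(k + 1)\<close> minus the \<open>d\<close>-th difference of \<open>L\<close> at \<open>k + 1\<close>.
  Applied to the powers of \<open>J\<close>, the same formula shows that the \<open>d\<close>-th difference of \<open>\<lambda>(R/J\<^sup>k)\<close> is
  \<open>\<lambda>(R/J)\<close>; comparing the Hilbert-Samuel functions of \<open>I\<close> and \<open>J\<close> through
  \<open>I\<^bsup>n+r\<^esup> \<subseteq> J\<^sup>n \<subseteq> I\<^sup>n\<close> gives \<open>e\<^sub>0(I) = \<lambda>(R/J)\<close>.\<close>

subsection \<open>Ideals\<close>

text \<open>\<open>depth_eq\<close> only supplies some regular sequence of length \<open>d\<close>
  in \<open>m\<close>, unrelated to \<open>J\<close>. It is traded for regular generators of
  \<open>J\<close> one at a time: a generator is altered by the others so as to avoid the finitely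
  many maximal annihilators, and an exchange argument keeps a regular sequence of the remaining
  length in reserve modulo the new element. A second obstacle is that \<open>hs_mult\<close> is a
  \<open>THE\<close>, unspecified until the Hilbert-Samuel function of \<open>I\<close> is known to
  be eventually polynomial. This comes from a Hilbert-Serre theorem for the graded module with
  components \<open>I^(r+n)/I^(r+n+1)\<close>, which the reduction equation makes generated in
  degree 0 over \<open>d\<close> variables. All modules are quotients of ideals of the one ring
  \<open>R\<close>: \<open>R/A\<close> is represented by \<open>A\<close>, isomorphisms by order
  isomorphisms of intervals of ideals, graded modules by two sequences of ideals. The binomials in
  the formula arise because the increments of \<open>L\<close> are the
  \<open>\<lambda>_F(j)\<close>: the \<open>d\<close>-th difference of \<open>L\<close> is the
  \<open>(d-1)\<close>-st difference of these.\<close>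

lemma is_idealI:
  assumes "0 \<in> A" "\<And>a b. a \<in> A \<Longrightarrow> b \<in> A \<Longrightarrow> a + b \<in> A" "\<And>r a. a \<in> A \<Longrightarrow> r * a \<in> A"
  shows "is_ideal A"
  using assms by (auto simp: is_ideal_def)

lemma ideal_zero: "is_ideal A \<Longrightarrow> 0 \<in> A"
  and ideal_add: "is_ideal A \<Longrightarrow> a \<in> A \<Longrightarrow> b \<in> A \<Longrightarrow> a + b \<in> A"
  and ideal_mult: "is_ideal A \<Longrightarrow> a \<in> A \<Longrightarrow> r * a \<in> A"
  by (auto simp: is_ideal_def)

lemma ideal_mult_right: "is_ideal A \<Longrightarrow> a \<in> A \<Longrightarrow> a * r \<in> A"
  using ideal_mult[of A a r] by (simp add: mult.commute)

lemma ideal_uminus: "is_ideal A \<Longrightarrow> a \<in> A \<Longrightarrow> - a \<in> A"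
  using ideal_mult[of A a "-1"] by simp

lemma ideal_diff: "is_ideal A \<Longrightarrow> a \<in> A \<Longrightarrow> b \<in> A \<Longrightarrow> a - b \<in> A"
  using ideal_add[of A a "-b"] ideal_uminus[of A b] by simp

lemma ideal_add_cancel: "is_ideal A \<Longrightarrow> b \<in> A \<Longrightarrow> a + b \<in> A \<longleftrightarrow> a \<in> A"
  using ideal_diff[of A "a + b" b] ideal_add[of A a b] by auto

lemma is_ideal_UNIV [simp]: "is_ideal UNIV"
  and is_ideal_zero [simp]: "is_ideal {0}"
  by (auto simp: is_ideal_def)

lemma is_ideal_Int: "is_ideal A \<Longrightarrow> is_ideal B \<Longrightarrow> is_ideal (A \<inter> B)"
  by (auto simp: is_ideal_def)

lemma ideal_eq_UNIV_iff: "is_ideal A \<Longrightarrow> A = UNIV \<longleftrightarrow> 1 \<in> A"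
  using ideal_mult[of A 1] by auto

definition ideal_sum :: "'a::comm_ring_1 set \<Rightarrow> 'a set \<Rightarrow> 'a set" where
  "ideal_sum A B = {a + b | a b. a \<in> A \<and> b \<in> B}"

lemma ideal_sumI: "a \<in> A \<Longrightarrow> b \<in> B \<Longrightarrow> a + b \<in> ideal_sum A B"
  by (auto simp: ideal_sum_def)

lemma ideal_sumE:
  assumes "z \<in> ideal_sum A B"
  obtains a b where "z = a + b" "a \<in> A" "b \<in> B"
  using assms by (auto simp: ideal_sum_def)

lemma is_ideal_sum:
  assumes "is_ideal A" "is_ideal B"
  shows "is_ideal (ideal_sum A B)"
proof (rule is_idealI)
  show "0 \<in> ideal_sum A B"
    using ideal_sumI[OF ideal_zero ideal_zero, OF assms] by simp
next
  fix a b assume "a \<in> ideal_sum A B" "b \<in> ideal_sum A B"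
  then obtain p q p' q' where "a = p + q" "b = p' + q'" "p \<in> A" "q \<in> B" "p' \<in> A" "q' \<in> B"
    by (auto simp: ideal_sum_def)
  then have "a + b = (p + p') + (q + q')" "p + p' \<in> A" "q + q' \<in> B"
    using assms ideal_add by (auto simp: algebra_simps)
  then show "a + b \<in> ideal_sum A B" by (metis ideal_sumI)
next
  fix r a assume "a \<in> ideal_sum A B"
  then show "r * a \<in> ideal_sum A B"
    by (elim ideal_sumE) (simp add: distrib_left ideal_sumI ideal_mult assms)
qed

lemma ideal_sum_upper1: "is_ideal B \<Longrightarrow> A \<subseteq> ideal_sum A B"
  using ideal_zero by (force simp: ideal_sum_def)

lemma ideal_sum_upper2: "is_ideal A \<Longrightarrow> B \<subseteq> ideal_sum A B"
  using ideal_zero by (force simp: ideal_sum_def)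

lemma ideal_sum_least: "is_ideal C \<Longrightarrow> A \<subseteq> C \<Longrightarrow> B \<subseteq> C \<Longrightarrow> ideal_sum A B \<subseteq> C"
  by (auto simp: ideal_sum_def intro!: ideal_add)

lemma ideal_sum_mono: "A \<subseteq> A' \<Longrightarrow> B \<subseteq> B' \<Longrightarrow> ideal_sum A B \<subseteq> ideal_sum A' B'"
  by (auto simp: ideal_sum_def)

lemma ideal_sum_commute: "ideal_sum A B = ideal_sum B A"
  by (auto simp: ideal_sum_def) (metis add.commute)+

lemma ideal_sum_assoc: "ideal_sum (ideal_sum A B) C = ideal_sum A (ideal_sum B C)"
  by (auto simp: ideal_sum_def) (metis add.assoc)+

lemma ideal_sum_UNIV: "is_ideal A \<Longrightarrow> ideal_sum A UNIV = UNIV"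
  using ideal_sum_upper2[of A UNIV] by auto

lemma ideal_sum_zero [simp]: "ideal_sum A {0} = A" "ideal_sum {0} A = A"
  by (auto simp: ideal_sum_def)

lemma is_ideal_image:
  assumes "is_ideal A" shows "is_ideal ((*) x ` A)"
proof (rule is_idealI)
  show "0 \<in> (*) x ` A" using ideal_zero[OF assms] by force
  show "a + b \<in> (*) x ` A" if "a \<in> (*) x ` A" "b \<in> (*) x ` A" for a b
    using that ideal_add[OF assms] by (auto simp: image_iff) (metis distrib_left)
  show "r * a \<in> (*) x ` A" if "a \<in> (*) x ` A" for r a
    using that ideal_mult[OF assms] by (auto simp: image_iff) (metis mult.left_commute)
qed

text \<open>The kernel of multiplication by \<open>x\<close> from \<open>M\<close> to
  \<open>R/N\<close>. The restriction to \<open>M\<close> lets \<open>M / colon N M x\<close> stand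
  for the image \<open>(xM + N)/N\<close>.\<close>

definition colon :: "'a::comm_ring_1 set \<Rightarrow> 'a set \<Rightarrow> 'a \<Rightarrow> 'a set" where
  "colon N M x = {r \<in> M. x * r \<in> N}"

lemma is_ideal_colon: "is_ideal N \<Longrightarrow> is_ideal M \<Longrightarrow> is_ideal (colon N M x)"
  by (rule is_idealI)
    (auto simp: colon_def ideal_zero ideal_add ideal_mult distrib_left mult.left_commute[of x])

subsection \<open>Length\<close>

lemma ideal_chain_refl: "is_ideal M \<Longrightarrow> ideal_chain M M 0"
  by (auto simp: ideal_chain_def)

lemma ideal_chain_step:
  assumes "ideal_chain K N n" "is_ideal M" "K \<subset> M"
  shows "ideal_chain M N (Suc n)"
proof -
  obtain C where C: "C 0 = N" "C n = K" "\<forall>i\<le>n. is_ideal (C i)" "\<forall>i<n. C i \<subset> C (Suc i)"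
    using assms by (auto simp: ideal_chain_def)
  show ?thesis unfolding ideal_chain_def
    by (rule exI[of _ "C(Suc n := M)"]) (use C assms in \<open>auto simp: less_Suc_eq le_Suc_eq\<close>)
qed

lemma ideal_chain_SucE:
  assumes "ideal_chain M N (Suc n)"
  obtains K where "ideal_chain K N n" "K \<subset> M" "is_ideal M"
proof -
  obtain C where C: "C 0 = N" "C (Suc n) = M" "\<forall>i\<le>Suc n. is_ideal (C i)" "\<forall>i<Suc n. C i \<subset> C (Suc i)"
    using assms by (auto simp: ideal_chain_def)
  have "ideal_chain (C n) N n" unfolding ideal_chain_def
    by (rule exI[of _ C]) (use C in auto)
  moreover have "C n \<subset> M" using C by (metis lessI)
  moreover have "is_ideal M" using C by auto
  ultimately show ?thesis using that by blast
qed

lemma ideal_chain_trans: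
  "ideal_chain M K q \<Longrightarrow> ideal_chain K N p \<Longrightarrow> ideal_chain M N (p + q)"
proof (induction q arbitrary: M)
  case 0
  then show ?case by (auto simp: ideal_chain_def)
next
  case (Suc q)
  then obtain M' where "ideal_chain M' K q" "M' \<subset> M" "is_ideal M" by (metis ideal_chain_SucE)
  then show ?case using ideal_chain_step Suc by fastforce
qed

text \<open>Intersecting a strict chain with a fixed ideal, or adding that ideal to it, leaves it
  only weakly increasing. Dropping repetitions gives a strict chain whose length counts the genuine
  steps.\<close>

lemma ideal_chain_of_weak_chain:
  assumes "\<And>i. i \<le> n \<Longrightarrow> is_ideal (D i)" "\<And>i. i < n \<Longrightarrow> D i \<subseteq> D (Suc i)"
  shows "ideal_chain (D n) (D 0) (card {i. i < n \<and> D i \<noteq> D (Suc i)})"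
  using assms
proof (induction n)
  case 0
  then show ?case by (simp add: ideal_chain_refl)
next
  case (Suc n)
  let ?S = "{i. i < n \<and> D i \<noteq> D (Suc i)}"
  have IH: "ideal_chain (D n) (D 0) (card ?S)" using Suc by auto
  show ?case
  proof (cases "D n = D (Suc n)")
    case True
    then have "{i. i < Suc n \<and> D i \<noteq> D (Suc i)} = ?S" by (auto simp: less_Suc_eq)
    then show ?thesis using IH True by simp
  next
    case False
    then have "{i. i < Suc n \<and> D i \<noteq> D (Suc i)} = insert n ?S" by (auto simp: less_Suc_eq)
    moreover have "D n \<subset> D (Suc n)" using False Suc.prems(2)[of n] by auto
    ultimately show ?thesis using ideal_chain_step[OF IH, of "D (Suc n)"] Suc.prems(1) by simp
  qed
qed

lemma ideal_chain_mono:
  assumes C: "\<forall>i<n. C i \<subset> C (Suc i)" and "i \<le> j" "j \<le> n"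
  shows "C i \<subseteq> C (j::nat)"
  using assms(2,3)
proof (induction j rule: dec_induct)
  case (step k)
  then show ?case using C by (metis Suc_le_lessD Suc_leD order.trans psubset_imp_subset)
qed simp

lemma ideal_chain_subset: "ideal_chain M N n \<Longrightarrow> N \<subseteq> M"
  unfolding ideal_chain_def using ideal_chain_mono by (metis le0 order_refl)

text \<open>\<open>qlength\<close> is a \<open>GREATEST\<close>, so it has a meaning only when the
  chain lengths are bounded. The bound is a predicate of its own, under which additivity is
  stated.\<close>

definition fin_len :: "'a::comm_ring_1 set \<Rightarrow> 'a set \<Rightarrow> bool" where
  "fin_len M N \<longleftrightarrow> is_ideal M \<and> is_ideal N \<and> N \<subseteq> M \<and> (\<exists>b. \<forall>n. ideal_chain M N n \<longrightarrow> n \<le> b)"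

lemma ideal_chain_exists:
  assumes "is_ideal M" "is_ideal N" "N \<subseteq> M"
  shows "\<exists>n. ideal_chain M N n"
  using assms ideal_chain_step[OF ideal_chain_refl[of N], of M] ideal_chain_refl[of M] by (cases "N = M") auto

lemma ideal_chain_qlength: "fin_len M N \<Longrightarrow> ideal_chain M N (qlength M N)"
  unfolding fin_len_def qlength_def using ideal_chain_exists by (metis GreatestI_nat)

lemma ideal_chain_le_qlength: "fin_len M N \<Longrightarrow> ideal_chain M N n \<Longrightarrow> n \<le> qlength M N"
  unfolding fin_len_def qlength_def by (metis Greatest_le_nat)

lemma fin_len_refl: "is_ideal M \<Longrightarrow> fin_len M M"
  and qlength_refl: "is_ideal M \<Longrightarrow> qlength M M = 0"
proof -
  assume M: "is_ideal M"
  have *: "n = 0" if "ideal_chain M M n" for n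
  proof (cases n)
    case (Suc k)
    then show ?thesis using that ideal_chain_subset by (metis ideal_chain_SucE psubsetE subset_antisym)
  qed
  then show 1: "fin_len M M" using M by (auto simp: fin_len_def)
  show "qlength M M = 0" using * ideal_chain_qlength[OF 1] by blast
qed

lemma modular_eq:
  assumes "is_ideal A" "is_ideal B" "A \<subseteq> B" "A \<inter> K = B \<inter> K" "ideal_sum A K = ideal_sum B K" "is_ideal K"
  shows "A = B"
proof
  show "B \<subseteq> A"
  proof
    fix b assume b: "b \<in> B"
    then have "b \<in> ideal_sum A K" using assms ideal_sum_upper1 by blast
    then obtain a k where ak: "b = a + k" "a \<in> A" "k \<in> K" by (rule ideal_sumE)
    then have "k \<in> B" using b assms ideal_diff[of B b a] by auto
    then show "b \<in> A" using ak assms ideal_add by blast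
  qed
qed fact

text \<open>A chain from \<open>N\<close> to \<open>M\<close> is intersected with \<open>K\<close>
  and added to \<open>K\<close>. By the modular law a strict step cannot become trivial in both
  images, so the chain is no longer than the two lengths together. Concatenating maximal chains
  gives the reverse inequality.\<close>

lemma
  assumes K: "fin_len M K" "fin_len K N"
  shows fin_len_trans: "fin_len M N"
    and qlength_additive: "qlength M N = qlength M K + qlength K N"
proof -
  have ids: "is_ideal M" "is_ideal K" "is_ideal N" "N \<subseteq> K" "K \<subseteq> M" using K by (auto simp: fin_len_def)
  have bound: "n \<le> qlength M K + qlength K N" if ch: "ideal_chain M N n" for n
  proof -
    obtain C where C: "C 0 = N" "C n = M" "\<forall>i\<le>n. is_ideal (C i)" "\<forall>i<n. C i \<subset> C (Suc i)"
      using ch by (auto simp: ideal_chain_def)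
    let ?S1 = "{i. i < n \<and> C i \<inter> K \<noteq> C (Suc i) \<inter> K}"
    let ?S2 = "{i. i < n \<and> ideal_sum (C i) K \<noteq> ideal_sum (C (Suc i)) K}"
    have "ideal_chain (C n \<inter> K) (C 0 \<inter> K) (card ?S1)"
      by (intro ideal_chain_of_weak_chain is_ideal_Int Int_mono psubset_imp_subset[of "C _"]) (use C ids in auto)
    moreover have "C n \<inter> K = K" "C 0 \<inter> K = N" using C ids by auto
    ultimately have 1: "card ?S1 \<le> qlength K N" using ideal_chain_le_qlength[OF K(2), of "card ?S1"] by simp
    have "ideal_chain (ideal_sum (C n) K) (ideal_sum (C 0) K) (card ?S2)"
      by (intro ideal_chain_of_weak_chain is_ideal_sum ideal_sum_mono psubset_imp_subset[of "C _"])
        (use C ids in auto)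
    moreover have "ideal_sum (C n) K = M" "ideal_sum (C 0) K = K"
      using ids unfolding C(1,2)
      by (intro equalityI ideal_sum_least ideal_sum_upper1 ideal_sum_upper2 subset_refl; simp)+
    ultimately have 2: "card ?S2 \<le> qlength M K" using ideal_chain_le_qlength[OF K(1), of "card ?S2"] by simp
    have "{i. i < n} \<subseteq> ?S1 \<union> ?S2"
    proof
      fix i assume i: "i \<in> {i. i < n}"
      show "i \<in> ?S1 \<union> ?S2"
      proof (rule ccontr)
        assume "\<not> ?thesis"
        then have "C i = C (Suc i)" using modular_eq[of "C i" "C (Suc i)" K] C ids i by auto
        then show False using C i by auto
      qed
    qed
    then have "card {i. i < n} \<le> card (?S1 \<union> ?S2)" by (intro card_mono) auto
    also have "\<dots> \<le> card ?S1 + card ?S2" by (rule card_Un_le)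
    finally show ?thesis using 1 2 by simp
  qed
  then show fl: "fin_len M N" using ids by (auto simp: fin_len_def)
  have "ideal_chain M N (qlength K N + qlength M K)"
    by (rule ideal_chain_trans[OF ideal_chain_qlength[OF K(1)] ideal_chain_qlength[OF K(2)]])
  then have "qlength K N + qlength M K \<le> qlength M N" using ideal_chain_le_qlength fl by blast
  then show "qlength M N = qlength M K + qlength K N" using bound ideal_chain_qlength[OF fl] by fastforce
qed

lemma fin_len_upper:
  assumes "fin_len M N" "is_ideal K" "N \<subseteq> K" "K \<subseteq> M"
  shows "fin_len M K"
proof -
  obtain p where p: "ideal_chain K N p" using assms ideal_chain_exists fin_len_def by metis
  obtain b where b: "\<forall>n. ideal_chain M N n \<longrightarrow> n \<le> b" using assms fin_len_def by metis
  have "n \<le> b" if "ideal_chain M K n" for n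
    using b ideal_chain_trans[OF that p] by fastforce
  then show ?thesis using assms by (auto simp: fin_len_def)
qed

lemma fin_len_lower:
  assumes "fin_len M N" "is_ideal K" "N \<subseteq> K" "K \<subseteq> M"
  shows "fin_len K N"
proof -
  obtain p where p: "ideal_chain M K p" using assms ideal_chain_exists fin_len_def by metis
  obtain b where b: "\<forall>n. ideal_chain M N n \<longrightarrow> n \<le> b" using assms fin_len_def by metis
  have "n \<le> b" if "ideal_chain K N n" for n
    using b ideal_chain_trans[OF p that] by fastforce
  then show ?thesis using assms by (auto simp: fin_len_def)
qed

lemma qlength_split:
  assumes "fin_len M N" "is_ideal K" "N \<subseteq> K" "K \<subseteq> M"
  shows "qlength M N = qlength M K + qlength K N"
  using qlength_additive fin_len_upper fin_len_lower assms by blast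

lemma fin_len_UNIV_mono: "fin_len UNIV A \<Longrightarrow> is_ideal B \<Longrightarrow> A \<subseteq> B \<Longrightarrow> fin_len UNIV B"
  using fin_len_upper by blast

lemma ideal_chain_map:
  assumes ch: "ideal_chain M N n" and "f M = M'" "f N = N'"
    and f: "\<And>C. is_ideal C \<Longrightarrow> N \<subseteq> C \<Longrightarrow> C \<subseteq> M \<Longrightarrow> is_ideal (f C) \<and> g (f C) = C"
    and mono: "\<And>C D. C \<subseteq> D \<Longrightarrow> f C \<subseteq> f D"
  shows "ideal_chain M' N' n"
proof -
  obtain C where C: "C 0 = N" "C n = M" "\<forall>i\<le>n. is_ideal (C i)" "\<forall>i<n. C i \<subset> C (Suc i)"
    using ch by (auto simp: ideal_chain_def)
  have rng: "N \<subseteq> C i \<and> C i \<subseteq> M" if "i \<le> n" for i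
    using C ideal_chain_mono[OF C(4), of 0 i] ideal_chain_mono[OF C(4), of i n] that by auto
  have gf: "is_ideal (f (C i)) \<and> g (f (C i)) = C i" if "i \<le> n" for i
    using f rng C that by auto
  show ?thesis unfolding ideal_chain_def
  proof (intro exI[of _ "\<lambda>i. f (C i)"] conjI allI impI)
    fix i assume i: "i < n"
    then have "f (C i) \<noteq> f (C (Suc i))" using gf[of i] gf[of "Suc i"] C(4) by (metis Suc_leI less_imp_le psubset_eq)
    then show "f (C i) \<subset> f (C (Suc i))" using mono C i by (metis psubset_eq)
  qed (use C assms gf in auto)
qed

text \<open>Multiplication by \<open>x\<close> induces an isomorphism from
  \<open>M / colon N M x\<close> onto \<open>(xM + N)/N\<close>. For ideals this means that
  \<open>?g\<close> and \<open>?f\<close> are inverse order-preserving maps between the two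
  intervals, so chains correspond.\<close>

lemma ideal_chain_mult_iff:
  assumes "is_ideal M" "is_ideal N"
  shows "ideal_chain (ideal_sum ((*) x ` M) N) N n \<longleftrightarrow> ideal_chain M (colon N M x) n"
proof
  let ?f = "\<lambda>C. colon C M x" and ?g = "\<lambda>D. ideal_sum ((*) x ` D) N"
  have gf: "?g (?f C) = C" if "is_ideal C" "N \<subseteq> C" "C \<subseteq> ideal_sum ((*) x ` M) N" for C
  proof
    show "?g (?f C) \<subseteq> C" by (rule ideal_sum_least) (use that in \<open>auto simp: colon_def\<close>)
    show "C \<subseteq> ?g (?f C)"
    proof
      fix c assume c: "c \<in> C"
      then have "c \<in> ideal_sum ((*) x ` M) N" using that by auto
      then obtain r b where rb: "c = x * r + b" "r \<in> M" "b \<in> N"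
        by (auto elim!: ideal_sumE)
      then have "x * r \<in> C" using c that ideal_diff[of C c b] by auto
      then show "c \<in> ?g (?f C)" using rb by (auto simp: colon_def intro!: ideal_sumI)
    qed
  qed
  have fg: "?f (?g D) = D" if "is_ideal D" "colon N M x \<subseteq> D" "D \<subseteq> M" for D
  proof
    show "D \<subseteq> ?f (?g D)" using that assms ideal_sum_upper1[of N "(*) x ` D"] by (auto simp: colon_def)
    show "?f (?g D) \<subseteq> D"
    proof
      fix r assume "r \<in> ?f (?g D)"
      then obtain e b where r: "r \<in> M" "x * r = x * e + b" "e \<in> D" "b \<in> N"
        by (auto simp: colon_def elim!: ideal_sumE)
      then have "x * (r - e) \<in> N" "r - e \<in> M"
        using that assms by (auto simp: right_diff_distrib intro: ideal_diff)
      then have "r - e \<in> D" using that by (auto simp: colon_def)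
      then show "r \<in> D" using r that ideal_add[of D "r - e" e] by auto
    qed
  qed
  have top: "?f (ideal_sum ((*) x ` M) N) = M"
    using assms ideal_sum_upper1[of N "(*) x ` M"] by (auto simp: colon_def)
  have bot: "?g (colon N M x) = N"
    by (intro antisym ideal_sum_least ideal_sum_upper2 is_ideal_image is_ideal_colon assms)
      (auto simp: colon_def)
  show "ideal_chain M (colon N M x) n" if "ideal_chain (ideal_sum ((*) x ` M) N) N n"
    by (rule ideal_chain_map[where f = ?f and g = ?g, OF that top refl])
      (use gf in \<open>auto simp: colon_def intro: is_ideal_colon[unfolded colon_def] assms\<close>)
  show "ideal_chain (ideal_sum ((*) x ` M) N) N n" if "ideal_chain M (colon N M x) n"
    by (rule ideal_chain_map[where f = ?g and g = ?f, OF that refl bot])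
      (use fg in \<open>auto intro: is_ideal_sum is_ideal_image assms elim!: ideal_sumE intro!: ideal_sumI\<close>)
qed

lemma qlength_mult:
  assumes "is_ideal M" "is_ideal N"
  shows "qlength (ideal_sum ((*) x ` M) N) N = qlength M (colon N M x)"
  using ideal_chain_mult_iff[OF assms] by (simp add: qlength_def)

lemma fin_len_mult:
  assumes "is_ideal M" "is_ideal N"
  shows "fin_len (ideal_sum ((*) x ` M) N) N \<longleftrightarrow> fin_len M (colon N M x)"
proof -
  have "colon N M x \<subseteq> M" by (auto simp: colon_def)
  then show ?thesis
    using ideal_chain_mult_iff[OF assms] assms ideal_sum_upper2[OF is_ideal_image[OF assms(1)]]
    by (simp add: fin_len_def is_ideal_sum is_ideal_image is_ideal_colon)
qed

subsection \<open>Noetherian local rings\<close>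

definition adjoin :: "'a::comm_ring_1 set \<Rightarrow> 'a \<Rightarrow> 'a set" where
  "adjoin A x = ideal_sum ((*) x ` UNIV) A"

lemma mem_adjoin_iff: "z \<in> adjoin A x \<longleftrightarrow> (\<exists>r. z - x * r \<in> A)"
proof
  assume "z \<in> adjoin A x"
  then obtain r b where "z = x * r + b" "b \<in> A"
    unfolding adjoin_def by (elim ideal_sumE) auto
  then show "\<exists>r. z - x * r \<in> A" by (intro exI[of _ r]) simp
next
  assume "\<exists>r. z - x * r \<in> A"
  then obtain r where "z - x * r \<in> A" by blast
  from ideal_sumI[OF _ this, of "x * r" "(*) x ` UNIV"] show "z \<in> adjoin A x"
    by (simp add: adjoin_def)
qed

lemma is_ideal_adjoin: "is_ideal A \<Longrightarrow> is_ideal (adjoin A x)"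
  by (simp add: adjoin_def is_ideal_sum is_ideal_image)

lemma adjoin_upper: "A \<subseteq> adjoin A x"
proof
  show "a \<in> adjoin A x" if "a \<in> A" for a
    unfolding mem_adjoin_iff by (rule exI[of _ 0]) (simp add: that)
qed

lemma self_in_adjoin: "is_ideal A \<Longrightarrow> x \<in> adjoin A x"
  unfolding mem_adjoin_iff by (rule exI[of _ 1]) (simp add: ideal_zero)

lemma adjoin_least: "is_ideal B \<Longrightarrow> A \<subseteq> B \<Longrightarrow> x \<in> B \<Longrightarrow> adjoin A x \<subseteq> B"
  unfolding adjoin_def by (rule ideal_sum_least) (auto intro: ideal_mult_right)

lemma adjoin_commute: "adjoin (adjoin A x) y = adjoin (adjoin A y) x"
  by (simp add: adjoin_def flip: ideal_sum_assoc) (simp add: ideal_sum_commute)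

lemma adjoin_add:
  assumes "is_ideal A" "k \<in> A"
  shows "adjoin A (x + k) = adjoin A x"
proof (intro antisym adjoin_least is_ideal_adjoin adjoin_upper assms)
  show "x + k \<in> adjoin A x"
    using assms adjoin_upper[of A x] self_in_adjoin[of A x] ideal_add[OF is_ideal_adjoin] by blast
  have "x + k - k \<in> adjoin A (x + k)"
    using assms adjoin_upper[of A "x + k"] self_in_adjoin[of A "x + k"] ideal_diff[OF is_ideal_adjoin] by blast
  then show "x \<in> adjoin A (x + k)" by simp
qed

lemma noetherian_stable:
  fixes f :: "nat \<Rightarrow> 'a::comm_ring_1 set"
  assumes "noetherian_ring TYPE('a)" "\<And>n. is_ideal (f n)" "\<And>n. f n \<subseteq> f (Suc n)"
  shows "\<exists>N. \<forall>n\<ge>N. f n = f N"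
  using assms(1)[unfolded noetherian_ring_def, THEN spec, of f] assms(2,3) by blast

lemma noetherian_maximal:
  fixes S :: "'a::comm_ring_1 set set"
  assumes noeth: "noetherian_ring TYPE('a)" and "S \<noteq> {}" and ideals: "\<And>A. A \<in> S \<Longrightarrow> is_ideal A"
  shows "\<exists>A\<in>S. \<forall>B\<in>S. A \<subseteq> B \<longrightarrow> B = A"
proof (rule ccontr)
  assume "\<not> ?thesis"
  then have step: "\<exists>B. B \<in> S \<and> A \<subset> B" if "A \<in> S" for A
    using that by blast
  have "\<exists>f. \<forall>n. f n \<in> S \<and> f n \<subset> f (Suc n)"
    by (rule dependent_nat_choice[of "\<lambda>_ A. A \<in> S" "\<lambda>_ A B. A \<subset> B"]) (use step \<open>S \<noteq> {}\<close> in auto)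
  then obtain f where f: "\<forall>n. f n \<in> S \<and> f n \<subset> f (Suc n)" ..
  have "\<exists>N. \<forall>n\<ge>N. f n = f N"
  proof (rule noetherian_stable[OF noeth])
    show "is_ideal (f n)" for n using f ideals by simp
    show "f n \<subseteq> f (Suc n)" for n using f by (simp add: psubset_imp_subset)
  qed
  then obtain N where "\<forall>n\<ge>N. f n = f N" ..
  then have "f (Suc N) = f N" using le_Suc_eq by blast
  then show False using f[THEN spec, of N] by simp
qed

section \<open>Prime avoidance\<close>

lemma prime_ideal_prod:
  assumes "is_prime_ideal P" "finite S" "\<And>Q. Q \<in> S \<Longrightarrow> is_ideal Q \<and> \<not> Q \<subseteq> P"
  shows "\<exists>e. e \<notin> P \<and> (\<forall>Q\<in>S. e \<in> Q)"
  using assms(2,3)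
proof (induction S rule: finite_induct)
  case empty
  then show ?case using assms by (auto simp: is_prime_ideal_def)
next
  case (insert Q S)
  then obtain e where e: "e \<notin> P" "\<forall>Q\<in>S. e \<in> Q" by auto
  obtain q where q: "q \<in> Q" "q \<notin> P" using insert.prems by blast
  have "e * q \<notin> P" using e q assms(1) by (auto simp: is_prime_ideal_def)
  moreover have "\<forall>Q'\<in>insert Q S. e * q \<in> Q'"
    using e q insert.prems by (auto intro: ideal_mult ideal_mult_right)
  ultimately show ?case by blast
qed

text \<open>Induction by removing a minimal member \<open>P\<close> of \<open>S\<close>. If the
  \<open>k\<close> found for the rest puts \<open>x + k\<close> into \<open>P\<close>, then
  \<open>K\<close> is not inside \<open>P\<close>, and by minimality neither is any other member. So
  some \<open>e\<close> lies in \<open>K\<close> and in all the other primes but not in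
  \<open>P\<close>; adding \<open>e\<close> repairs \<open>P\<close> and changes nothing modulo the
  others.\<close>

lemma prime_avoidance_coset:
  assumes "finite S" "is_ideal K" "\<And>P. P \<in> S \<Longrightarrow> is_prime_ideal P" "\<And>P. P \<in> S \<Longrightarrow> \<not> (x \<in> P \<and> K \<subseteq> P)"
  shows "\<exists>k\<in>K. \<forall>P\<in>S. x + k \<notin> P"
  using assms(1,3,4)
proof (induction S rule: finite_psubset_induct)
  case (psubset S)
  show ?case
  proof (cases "S = {}")
    case True
    then show ?thesis using assms(2) ideal_zero by auto
  next
    case False
    then obtain P where P: "P \<in> S" "\<forall>Q\<in>S. Q \<subseteq> P \<longrightarrow> P = Q"
      using finite_has_minimal[of S] psubset.hyps by auto
    obtain k where k: "k \<in> K" "\<forall>Q\<in>S - {P}. x + k \<notin> Q"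
      using psubset.IH[of "S - {P}"] psubset.prems P by blast
    have prime: "is_prime_ideal P" and idP: "is_ideal P"
      using P psubset.prems by (auto simp: is_prime_ideal_def)
    show ?thesis
    proof (cases "x + k \<in> P")
      case False
      then show ?thesis using k by blast
    next
      case True
      have "\<not> K \<subseteq> P"
        using psubset.prems(2)[OF P(1)] True k ideal_diff[OF idP True, of k] by auto
      then have "is_ideal Q \<and> \<not> Q \<subseteq> P" if "Q \<in> insert K (S - {P})" for Q
        using that psubset.prems(1)[of Q] P assms(2) by (auto simp: is_prime_ideal_def)
      then obtain e where e: "e \<notin> P" "\<forall>Q\<in>insert K (S - {P}). e \<in> Q"
        using prime_ideal_prod[OF prime, of "insert K (S - {P})"] psubset.hyps by (metis finite_Diff finite_insert)
      have "x + (k + e) \<notin> Q" if "Q \<in> S" for Q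
      proof (cases "Q = P")
        case True
        then show ?thesis using e(1) ideal_add_cancel[OF idP \<open>x + k \<in> P\<close>, of e]
          by (simp add: algebra_simps)
      next
        case False
        then have "e \<in> Q" "x + k \<notin> Q" "is_ideal Q"
          using that e k psubset.prems by (auto simp: is_prime_ideal_def)
        then show ?thesis using ideal_add_cancel[of Q e "x + k"] by (simp add: algebra_simps)
      qed
      moreover have "k + e \<in> K" using k e assms(2) by (auto intro: ideal_add)
      ultimately show ?thesis by blast
    qed
  qed
qed

section \<open>Zero divisors modulo an ideal\<close>

definition regular_on :: "'a::comm_ring_1 set \<Rightarrow> 'a \<Rightarrow> bool" where
  "regular_on A x \<longleftrightarrow> (\<forall>r. x * r \<in> A \<longrightarrow> r \<in> A)"

text \<open>The maximal annihilators of nonzero elements of \<open>R/A\<close>, that is, its maximal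
  associated primes. In a Noetherian ring their union is the set of zero divisors modulo
  \<open>A\<close>, and they are finite in number, as prime avoidance requires.\<close>

definition max_ann :: "'a::comm_ring_1 set \<Rightarrow> 'a set set" where
  "max_ann A = {colon A UNIV c | c. c \<notin> A \<and> (\<forall>b. b \<notin> A \<longrightarrow> colon A UNIV c \<subseteq> colon A UNIV b \<longrightarrow> colon A UNIV b = colon A UNIV c)}"

lemma max_annE:
  assumes "P \<in> max_ann A"
  obtains c where "P = colon A UNIV c" "c \<notin> A"
    "\<forall>b. b \<notin> A \<longrightarrow> P \<subseteq> colon A UNIV b \<longrightarrow> colon A UNIV b = P"
  using assms unfolding max_ann_def by blast

text \<open>If \<open>a\<close> does not kill \<open>c\<close> modulo \<open>A\<close>, then
  \<open>c * a\<close> is again nonzero and its annihilator contains \<open>P\<close>, hence equals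
  \<open>P\<close> by maximality.\<close>

lemma max_ann_prime:
  assumes A: "is_ideal A" and P: "P \<in> max_ann A"
  shows "is_prime_ideal P"
proof -
  obtain c where c: "P = colon A UNIV c" "c \<notin> A"
    and max: "\<forall>b. b \<notin> A \<longrightarrow> P \<subseteq> colon A UNIV b \<longrightarrow> colon A UNIV b = P"
    using P by (rule max_annE)
  have "1 \<notin> P" using c by (simp add: colon_def)
  moreover have "b \<in> P" if "a * b \<in> P" "a \<notin> P" for a b
  proof -
    have "c * a \<notin> A" using that c by (simp add: colon_def)
    moreover have "P \<subseteq> colon A UNIV (c * a)"
    proof
      fix r assume "r \<in> P"
      then have "a * (c * r) \<in> A" using c ideal_mult[OF A] by (simp add: colon_def)
      then show "r \<in> colon A UNIV (c * a)" by (simp add: colon_def algebra_simps)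
    qed
    ultimately have "colon A UNIV (c * a) = P" using max by blast
    moreover have "b \<in> colon A UNIV (c * a)" using that c by (simp add: colon_def algebra_simps)
    ultimately show ?thesis by simp
  qed
  ultimately show ?thesis using is_ideal_colon[OF A is_ideal_UNIV, of c] c
    by (auto simp: is_prime_ideal_def)
qed

lemma max_ann_cover:
  fixes A :: "'a::comm_ring_1 set"
  assumes "noetherian_ring TYPE('a)" and A: "is_ideal A" and r: "r \<notin> A"
  obtains P where "P \<in> max_ann A" "colon A UNIV r \<subseteq> P"
proof -
  let ?S = "{colon A UNIV c | c. c \<notin> A \<and> colon A UNIV r \<subseteq> colon A UNIV c}"
  have "\<exists>P\<in>?S. \<forall>B\<in>?S. P \<subseteq> B \<longrightarrow> B = P"
    by (rule noetherian_maximal[OF assms(1)]) (use r is_ideal_colon[OF A is_ideal_UNIV] in auto)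
  then obtain P where P: "P \<in> ?S" "\<forall>B\<in>?S. P \<subseteq> B \<longrightarrow> B = P" by blast
  then obtain c where c: "P = colon A UNIV c" "c \<notin> A" "colon A UNIV r \<subseteq> P" by blast
  have "colon A UNIV b = P" if "b \<notin> A" "P \<subseteq> colon A UNIV b" for b
  proof -
    have "colon A UNIV b \<in> ?S" using that c(3) by blast
    then show ?thesis using P(2) that(2) by blast
  qed
  then have "P \<in> max_ann A" unfolding max_ann_def using c(1,2) by blast
  then show ?thesis using c(3) that by blast
qed

text \<open>If \<open>P\<^sub>i = (A : c\<^sub>i)\<close> were infinitely many, then some \<open>c\<^sub>N\<close> would lie in
  \<open>A + (c\<^sub>0, \<dots>, c\<^sub>N\<^sub>-\<^sub>1)\<close>, so that \<open>P\<^sub>0 \<inter> \<dots> \<inter> P\<^sub>N\<^sub>-\<^sub>1 \<subseteq> P\<^sub>N\<close>.\<close>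
lemma finite_max_ann:
  fixes A :: "'a::comm_ring_1 set"
  assumes noeth: "noetherian_ring TYPE('a)" and A: "is_ideal A"
  shows "finite (max_ann A)"
proof (rule ccontr)
  assume "infinite (max_ann A)"
  then obtain P :: "nat \<Rightarrow> 'a set" where P: "inj P" "\<And>n. P n \<in> max_ann A"
    by (metis infinite_countable_subset range_subsetD)
  have "\<forall>n. \<exists>c. P n = colon A UNIV c \<and> c \<notin> A" using P(2) by (metis max_annE)
  then obtain c where c: "\<And>n. P n = colon A UNIV (c n)" "\<And>n. c n \<notin> A" by metis
  define G where "G = rec_nat A (\<lambda>n B. adjoin B (c n))"
  have G: "G 0 = A" "\<And>n. G (Suc n) = adjoin (G n) (c n)" by (auto simp: G_def)
  have idG: "is_ideal (G n)" for n by (induction n) (auto simp: G A is_ideal_adjoin)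
  have "\<exists>N. \<forall>n\<ge>N. G n = G N"
    by (rule noetherian_stable[OF noeth]) (simp_all add: idG G(2) adjoin_upper)
  then obtain N where "\<forall>n\<ge>N. G n = G N" ..
  then have "G (Suc N) = G N" using le_Suc_eq by blast
  then have cN: "c N \<in> G N" using G(2)[of N] self_in_adjoin[OF idG] by auto
  have kill: "e * z \<in> A" if "z \<in> G n" "\<forall>i<n. e \<in> P i" for e z n
    using that
  proof (induction n arbitrary: z)
    case 0
    then show ?case using A by (simp add: G ideal_mult)
  next
    case (Suc n)
    then obtain r where r: "z - c n * r \<in> G n" by (auto simp: G mem_adjoin_iff)
    then have "e * (z - c n * r) \<in> A" using Suc by auto
    moreover have "e \<in> P n" using Suc.prems by blast
    then have "c n * e \<in> A" using c(1)[of n] by (simp add: colon_def)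
    then have "(c n * e) * r \<in> A" using A by (simp add: ideal_mult_right)
    ultimately have "e * (z - c n * r) + (c n * e) * r \<in> A" using A by (simp add: ideal_add)
    then show ?case by (simp add: algebra_simps)
  qed
  have "\<not> P i \<subseteq> P N" if "i < N" for i
  proof
    assume le: "P i \<subseteq> P N"
    have "\<forall>b. b \<notin> A \<longrightarrow> P i \<subseteq> colon A UNIV b \<longrightarrow> colon A UNIV b = P i"
      using P(2)[of i] by (rule max_annE)
    then have "P N = P i" using c(2)[of N] le unfolding c(1)[of N] by blast
    then show False using P(1) that by (auto dest: injD)
  qed
  then obtain e where e: "e \<notin> P N" "\<forall>Q\<in>P ` {..<N}. e \<in> Q"
    using prime_ideal_prod[OF max_ann_prime[OF A P(2)[of N]], of "P ` {..<N}"]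
      max_ann_prime[OF A P(2)] by (auto simp: is_prime_ideal_def)
  then have "e * c N \<in> A" using kill[OF cN] by auto
  then show False using e(1) c(1)[of N] by (simp add: colon_def mult.commute)
qed

lemma regular_on_if_avoids:
  fixes A :: "'a::comm_ring_1 set"
  assumes "noetherian_ring TYPE('a)" "is_ideal A" "\<And>P. P \<in> max_ann A \<Longrightarrow> x \<notin> P"
  shows "regular_on A x"
  unfolding regular_on_def
proof (intro allI impI, rule ccontr)
  fix r assume r: "x * r \<in> A" "r \<notin> A"
  obtain P where "P \<in> max_ann A" "colon A UNIV r \<subseteq> P" using max_ann_cover[OF assms(1,2) r(2)] .
  then show False using r assms(3) by (auto simp: colon_def mult.commute)
qed

lemma regular_on_avoids: "regular_on A x \<Longrightarrow> P \<in> max_ann A \<Longrightarrow> x \<notin> P"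
  by (auto simp: regular_on_def colon_def mult.commute elim!: max_annE)

text \<open>One half of permuting a regular sequence: a relation \<open>a r = b s\<close> modulo
  \<open>A\<close> forces \<open>s\<close> to be a multiple of \<open>a\<close> modulo
  \<open>A\<close>, and then \<open>a\<close> cancels.\<close>

lemma regular_on_swap:
  assumes A: "is_ideal A" and "regular_on A a" "regular_on (adjoin A a) b"
  shows "regular_on (adjoin A b) a"
  unfolding regular_on_def
proof (intro allI impI)
  fix r assume "a * r \<in> adjoin A b"
  then obtain s where s: "a * r - b * s \<in> A" by (auto simp: mem_adjoin_iff)
  then have "- (a * r - b * s) \<in> A" using A ideal_uminus by blast
  then have "b * s - a * r \<in> A" by simp
  then have "b * s \<in> adjoin A a" unfolding mem_adjoin_iff by blast
  then have "s \<in> adjoin A a" using assms by (auto simp: regular_on_def)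
  then obtain t where t: "s - a * t \<in> A" by (auto simp: mem_adjoin_iff)
  have "(a * r - b * s) + b * (s - a * t) \<in> A" using s t A by (intro ideal_add ideal_mult)
  then have "a * (r - b * t) \<in> A" by (simp add: algebra_simps)
  then have "r - b * t \<in> A" using assms by (auto simp: regular_on_def)
  then show "r \<in> adjoin A b" by (auto simp: mem_adjoin_iff)
qed

text \<open>For the maximal ideal \<open>m\<close> of a Noetherian local ring this says that
  \<open>R/A\<close> has positive depth. Unlike the choice of a regular element, the condition can
  be carried from \<open>R/(A + y)\<close> to \<open>R/(A + x)\<close>.\<close>

definition no_socle :: "'a::comm_ring_1 set \<Rightarrow> 'a set \<Rightarrow> bool" where
  "no_socle m A \<longleftrightarrow> (\<forall>u. (\<forall>s\<in>m. s * u \<in> A) \<longrightarrow> u \<in> A)"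

lemma no_socle_if_regular: "x \<in> m \<Longrightarrow> regular_on A x \<Longrightarrow> no_socle m A"
  by (auto simp: no_socle_def regular_on_def)

text \<open>The socles of \<open>R/(A + x)\<close> and \<open>R/(A + y)\<close> are isomorphic, by sending \<open>u\<close> to the \<open>v\<close>
  with \<open>y u = x v\<close> modulo \<open>A\<close>.\<close>
lemma no_socle_exchange:
  assumes A: "is_ideal A" and x: "regular_on A x" and y: "regular_on A y" "y \<in> m"
    and ns: "no_socle m (adjoin A y)"
  shows "no_socle m (adjoin A x)"
  unfolding no_socle_def
proof (intro allI impI)
  fix u assume u: "\<forall>s\<in>m. s * u \<in> adjoin A x"
  then obtain v where v: "y * u - x * v \<in> A" using y(2) unfolding mem_adjoin_iff by blast
  have "s * v \<in> adjoin A y" if s: "s \<in> m" for s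
  proof -
    obtain t where t: "s * u - x * t \<in> A" using u s unfolding mem_adjoin_iff by blast
    have "y * (s * u - x * t) - s * (y * u - x * v) \<in> A"
      by (rule ideal_diff[OF A ideal_mult[OF A t] ideal_mult[OF A v]])
    then have "x * (s * v - y * t) \<in> A" by (simp add: algebra_simps)
    then have "s * v - y * t \<in> A" using x by (simp add: regular_on_def)
    then show ?thesis by (auto simp: mem_adjoin_iff)
  qed
  then have "v \<in> adjoin A y" using ns by (simp add: no_socle_def)
  then obtain w where w: "v - y * w \<in> A" by (auto simp: mem_adjoin_iff)
  have "(y * u - x * v) + x * (v - y * w) \<in> A" using v w A by (intro ideal_add ideal_mult)
  then have "y * (u - x * w) \<in> A" by (simp add: algebra_simps)
  then have "u - x * w \<in> A" using y by (simp add: regular_on_def)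
  then show "u \<in> adjoin A x" by (auto simp: mem_adjoin_iff)
qed

text \<open>If a maximal annihilator \<open>(C : c)\<close> contained \<open>m\<close>, then
  \<open>c\<close> would be a nonzero socle element of \<open>R/C\<close>. So \<open>m\<close> lies
  in none of the finitely many maximal annihilators for \<open>A\<close> and \<open>B\<close>
  together, and prime avoidance in the coset \<open>0 + m\<close> yields \<open>w\<close>.\<close>

lemma common_regular_element:
  fixes A B m :: "'a::comm_ring_1 set"
  assumes noeth: "noetherian_ring TYPE('a)" and "is_ideal m" "is_ideal A" "is_ideal B"
    and "no_socle m A" "no_socle m B"
  obtains w where "w \<in> m" "regular_on A w" "regular_on B w"
proof -
  have not_sub: "\<not> m \<subseteq> P" if P: "P \<in> max_ann C" and ns: "no_socle m C" for C P
  proof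
    assume sub: "m \<subseteq> P"
    obtain c where c: "P = colon C UNIV c" "c \<notin> C" using P by (rule max_annE)
    then have "\<forall>s\<in>m. s * c \<in> C" using sub by (auto simp: colon_def mult.commute)
    then show False using ns c by (simp add: no_socle_def)
  qed
  have "\<exists>k\<in>m. \<forall>P\<in>max_ann A \<union> max_ann B. 0 + k \<notin> P"
    by (rule prime_avoidance_coset)
      (use assms not_sub finite_max_ann[OF noeth] max_ann_prime in auto)
  then obtain w where "w \<in> m" "\<forall>P\<in>max_ann A \<union> max_ann B. w \<notin> P" by auto
  then show ?thesis using that assms regular_on_if_avoids[OF noeth] by auto
qed

section \<open>Regular sequences as lists\<close>

primrec regseq :: "'a::comm_ring_1 set \<Rightarrow> 'a list \<Rightarrow> 'a set \<Rightarrow> bool" where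
  "regseq m [] A \<longleftrightarrow> True"
| "regseq m (x # xs) A \<longleftrightarrow> x \<in> m \<and> regular_on A x \<and> regseq m xs (adjoin A x)"

primrec adjoin_list :: "'a::comm_ring_1 list \<Rightarrow> 'a set \<Rightarrow> 'a set" where
  "adjoin_list [] A = A"
| "adjoin_list (x # xs) A = adjoin_list xs (adjoin A x)"

lemma is_ideal_adjoin_list: "is_ideal A \<Longrightarrow> is_ideal (adjoin_list xs A)"
  by (induction xs arbitrary: A) (auto simp: is_ideal_adjoin)

lemma adjoin_list_adjoin: "adjoin_list xs (adjoin A x) = adjoin (adjoin_list xs A) x"
  by (induction xs arbitrary: A) (simp_all add: adjoin_commute[of _ x])

lemma adjoin_list_upper: "A \<subseteq> adjoin_list xs A"
proof (induction xs)
  case (Cons x xs)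
  then show ?case using adjoin_upper[of "adjoin_list xs A" x] by (auto simp: adjoin_list_adjoin)
qed simp

lemma adjoin_list_set: "is_ideal A \<Longrightarrow> set xs \<subseteq> adjoin_list xs A"
proof (induction xs)
  case (Cons x xs)
  then have "x \<in> adjoin (adjoin_list xs A) x"
    by (intro self_in_adjoin is_ideal_adjoin_list)
  then show ?case using Cons adjoin_upper[of "adjoin_list xs A" x] by (auto simp: adjoin_list_adjoin)
qed simp

lemma adjoin_list_least: "is_ideal B \<Longrightarrow> A \<subseteq> B \<Longrightarrow> set xs \<subseteq> B \<Longrightarrow> adjoin_list xs A \<subseteq> B"
  by (induction xs arbitrary: A) (auto simp: adjoin_least)

lemma adjoin_list_eq_gen_ideal: "adjoin_list xs {0} = gen_ideal (set xs)"
proof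
  show "adjoin_list xs {0} \<subseteq> gen_ideal (set xs)"
    unfolding gen_ideal_def by (intro Inter_greatest adjoin_list_least) (simp_all add: ideal_zero)
  show "gen_ideal (set xs) \<subseteq> adjoin_list xs {0}"
    unfolding gen_ideal_def by (rule Inter_lower) (auto simp: is_ideal_adjoin_list adjoin_list_set)
qed

lemma regseq_of_nth:
  assumes "\<And>i. i < length xs \<Longrightarrow> xs ! i \<in> m \<and> regular_on (adjoin_list (take i xs) A) (xs ! i)"
  shows "regseq m xs A"
  using assms
proof (induction xs arbitrary: A)
  case (Cons x xs)
  have "regseq m xs (adjoin A x)"
    by (rule Cons.IH) (use Cons.prems[of "Suc _"] in auto)
  then show ?case using Cons.prems[of 0] by auto
qed simp

lemma regseq_append:
  "regseq m (xs @ [x]) A \<longleftrightarrow> regseq m xs A \<and> x \<in> m \<and> regular_on (adjoin_list xs A) x"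
  by (induction xs arbitrary: A) auto

section \<open>Finite length and regular generators over a Noetherian local ring\<close>

locale noeth_local =
  fixes m :: "'a::comm_ring_1 set"
  assumes local: "local_ring m"
begin

lemma noeth: "noetherian_ring TYPE('a)"
  and is_ideal_m: "is_ideal m"
  using local by (auto simp: local_ring_def is_maximal_ideal_def)

lemma ideal_le_m:
  assumes "is_ideal A" "A \<noteq> UNIV"
  shows "A \<subseteq> m"
proof -
  let ?S = "{B. is_ideal B \<and> B \<noteq> UNIV \<and> A \<subseteq> B}"
  have "\<exists>M\<in>?S. \<forall>B\<in>?S. M \<subseteq> B \<longrightarrow> B = M"
    by (rule noetherian_maximal[OF noeth]) (use assms in auto)
  then obtain M where M: "M \<in> ?S" "\<forall>B\<in>?S. M \<subseteq> B \<longrightarrow> B = M" by blast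
  then have "is_maximal_ideal M" unfolding is_maximal_ideal_def by blast
  then have "M = m" using local by (simp add: local_ring_def)
  then show ?thesis using M by auto
qed

lemma prime_ge_m:
  assumes "is_prime_ideal P" "A \<subseteq> P" "m \<subseteq> radical A"
  shows "P = m"
proof -
  have "1 \<notin> P" using assms(1) ideal_eq_UNIV_iff[of P] by (auto simp: is_prime_ideal_def)
  have "x \<in> P" if "x \<in> m" for x
  proof -
    have "\<exists>n. x ^ n \<in> P" using assms(2,3) that unfolding radical_def by blast
    then obtain n where "x ^ n \<in> P" ..
    then show ?thesis
      by (induction n) (use assms(1) \<open>1 \<notin> P\<close> in \<open>auto simp: is_prime_ideal_def\<close>)
  qed
  then show ?thesis using ideal_le_m[of P] assms by (auto simp: is_prime_ideal_def)
qed

lemma fin_len_m: "fin_len UNIV m"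
proof -
  have "n \<le> 1" if ch: "ideal_chain UNIV m n" for n
  proof (rule ccontr)
    assume "\<not> n \<le> 1"
    then obtain k where k: "n = Suc (Suc k)" by (metis One_nat_def not0_implies_Suc not_less_eq_eq le0)
    then obtain K where K: "ideal_chain K m (Suc k)" "K \<subset> UNIV" using ch ideal_chain_SucE by metis
    then obtain K' where "ideal_chain K' m k" "K' \<subset> K" "is_ideal K" using ideal_chain_SucE by metis
    then have "m \<subset> K" using ideal_chain_subset by blast
    then show False using K \<open>is_ideal K\<close> ideal_le_m by auto
  qed
  then show ?thesis using is_ideal_m by (auto simp: fin_len_def)
qed

text \<open>A counterexample \<open>B\<close> maximal under inclusion has a maximal annihilator
  \<open>(B : c)\<close>. This prime contains \<open>B\<close>, hence is \<open>m\<close>, so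
  \<open>(B + (c))/B\<close> is a copy of \<open>R/m\<close>. By maximality
  \<open>R/(B + (c))\<close> has finite length, and additivity contradicts the choice of
  \<open>B\<close>.\<close>

lemma fin_len_if_radical:
  assumes "is_ideal A" "m \<subseteq> radical A"
  shows "fin_len UNIV A"
proof (rule ccontr)
  assume contr: "\<not> ?thesis"
  let ?S = "{B. is_ideal B \<and> m \<subseteq> radical B \<and> \<not> fin_len UNIV B}"
  have "\<exists>B\<in>?S. \<forall>C\<in>?S. B \<subseteq> C \<longrightarrow> C = B"
    by (rule noetherian_maximal[OF noeth]) (use assms contr in auto)
  then obtain B where B: "B \<in> ?S" "\<forall>C\<in>?S. B \<subseteq> C \<longrightarrow> C = B" by blast
  then have idB: "is_ideal B" and radB: "m \<subseteq> radical B" by auto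
  have "B \<noteq> UNIV" using B fin_len_refl by force
  then have "1 \<notin> B" using idB by (simp add: ideal_eq_UNIV_iff)
  then obtain P where "P \<in> max_ann B" using max_ann_cover[OF noeth idB] by metis
  moreover obtain c where c: "P = colon B UNIV c" "c \<notin> B" using calculation by (metis max_annE)
  moreover have "B \<subseteq> P" using idB by (auto simp: c colon_def ideal_mult)
  ultimately have "P = m" using prime_ge_m[OF max_ann_prime[OF idB]] radB by blast
  then have lower: "fin_len (adjoin B c) B"
    using fin_len_mult[OF is_ideal_UNIV idB, of c] fin_len_m c by (simp add: adjoin_def)
  have "adjoin B c \<noteq> B" using c(2) self_in_adjoin[OF idB] by auto
  moreover have "m \<subseteq> radical (adjoin B c)"
    using radB adjoin_upper[of B c] by (fastforce simp: radical_def)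
  ultimately have "fin_len UNIV (adjoin B c)"
    using B(2) adjoin_upper[of B c] is_ideal_adjoin[OF idB] by blast
  then have "fin_len UNIV B" using lower fin_len_trans by blast
  then show False using B by auto
qed

text \<open>A common nonzerodivisor \<open>w\<close> modulo \<open>A + x\<close> and modulo \<open>A + y\<close>, where \<open>y\<close> is the head of \<open>ys\<close>,
  allows trading first \<open>y\<close> for \<open>w\<close> and then \<open>w\<close> for \<open>x\<close>.\<close>
lemma regseq_exchange:
  assumes "is_ideal A" "regseq m ys A" "length ys = Suc e" "x \<in> m" "regular_on A x"
  shows "\<exists>zs. length zs = e \<and> regseq m zs (adjoin A x)"
  using assms
proof (induction e arbitrary: A ys x)
  case 0
  then show ?case by simp
next
  case (Suc e)
  then obtain y z ys' where ys: "ys = y # z # ys'" by (metis Suc_length_conv)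
  have y: "y \<in> m" "regular_on A y" "regseq m (z # ys') (adjoin A y)" and z: "z \<in> m" "regular_on (adjoin A y) z"
    using Suc.prems ys by auto
  note idA = \<open>is_ideal A\<close>
  have ns: "no_socle m (adjoin A y)" using z no_socle_if_regular by blast
  then have "no_socle m (adjoin A x)" using no_socle_exchange Suc.prems y by blast
  then obtain w where w: "w \<in> m" "regular_on (adjoin A y) w" "regular_on (adjoin A x) w"
    using common_regular_element[OF noeth is_ideal_m is_ideal_adjoin[OF idA] is_ideal_adjoin[OF idA] ns] by metis
  obtain us where us: "length us = e" "regseq m us (adjoin (adjoin A y) w)"
    using Suc.IH[OF is_ideal_adjoin[OF idA] y(3) _ w(1,2)] Suc.prems ys by auto
  have "regseq m (y # us) (adjoin A w)"
    using us y w regular_on_swap[OF idA y(2) w(2)] by (simp add: adjoin_commute[of A y w])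
  moreover have "regular_on (adjoin A w) x" using regular_on_swap[OF idA _ w(3)] Suc.prems by blast
  ultimately obtain vs where "length vs = e" "regseq m vs (adjoin (adjoin A w) x)"
    using Suc.IH[OF is_ideal_adjoin[OF idA], of "y # us" w x] us Suc.prems by auto
  then have "length (w # vs) = Suc e" "regseq m (w # vs) (adjoin A x)"
    using w by (auto simp: adjoin_commute[of A w x])
  then show ?case by blast
qed

text \<open>Adding to \<open>x\<close> an element \<open>k\<close> of \<open>?K\<close> does not
  change the ideal generated by \<open>?K\<close> and \<open>x\<close>. A prime in
  \<open>max_ann A\<close> containing \<open>x\<close> and \<open>?K\<close> would equal
  \<open>m\<close>, yet \<open>m\<close> contains the regular element \<open>y\<close>; so some
  \<open>x + k\<close> is regular modulo \<open>A\<close>. The exchange lemma then supplies the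
  regular sequence that the remaining generators need.\<close>

lemma regseq_generators:
  assumes "is_ideal A" "regseq m ys A" "length ys = length xs"
    and "m \<subseteq> radical (adjoin_list xs A)" "adjoin_list xs A \<subseteq> m"
  shows "\<exists>zs. length zs = length xs \<and> adjoin_list zs A = adjoin_list xs A \<and> regseq m zs A"
  using assms
proof (induction xs arbitrary: A ys)
  case Nil
  then show ?case by auto
next
  case (Cons x xs)
  let ?K = "adjoin_list xs A"
  note idA = \<open>is_ideal A\<close>
  have idK: "is_ideal ?K" using idA by (rule is_ideal_adjoin_list)
  obtain y ys' where ys: "ys = y # ys'" "length ys' = length xs" using Cons.prems by (metis Suc_length_conv length_Cons)
  then have y: "y \<in> m" "regular_on A y" using Cons.prems by auto
  have avoid: "\<not> (x \<in> P \<and> ?K \<subseteq> P)" if P: "P \<in> max_ann A" for P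
  proof
    assume asm: "x \<in> P \<and> ?K \<subseteq> P"
    have "is_prime_ideal P" using max_ann_prime[OF idA P] .
    moreover have "adjoin ?K x \<subseteq> P"
      using asm calculation by (intro adjoin_least) (auto simp: is_prime_ideal_def)
    ultimately have "P = m" using prime_ge_m Cons.prems(4) by (auto simp: adjoin_list_adjoin)
    then show False using y regular_on_avoids[OF _ P] by auto
  qed
  have "\<exists>k\<in>?K. \<forall>P\<in>max_ann A. x + k \<notin> P"
    by (rule prime_avoidance_coset)
      (use avoid finite_max_ann[OF noeth idA] max_ann_prime[OF idA] idK in auto)
  then obtain k where k: "k \<in> ?K" "\<forall>P\<in>max_ann A. x + k \<notin> P" by blast
  let ?x = "x + k"
  have eq: "adjoin_list xs (adjoin A ?x) = adjoin_list (x # xs) A"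
    using adjoin_add[OF idK k(1)] by (simp add: adjoin_list_adjoin)
  have reg: "regular_on A ?x" using regular_on_if_avoids[OF noeth idA] k by blast
  have "?x \<in> adjoin_list xs (adjoin A ?x)"
    using adjoin_list_upper self_in_adjoin[OF idA] by blast
  then have xm: "?x \<in> m" using Cons.prems(5) unfolding eq by blast
  obtain us where us: "length us = length xs" "regseq m us (adjoin A ?x)"
    using regseq_exchange[OF idA Cons.prems(2) _ xm reg, of "length xs"] ys by auto
  obtain zs where zs: "length zs = length xs" "adjoin_list zs (adjoin A ?x) = adjoin_list xs (adjoin A ?x)"
      "regseq m zs (adjoin A ?x)"
    using Cons.IH[OF is_ideal_adjoin[OF idA] us(2,1)] Cons.prems(4,5) eq by auto
  show ?case
    by (rule exI[of _ "?x # zs"]) (use zs eq reg xm in auto)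
qed

end

subsection \<open>Standard filtrations\<close>

primrec lin_comb :: "'a::comm_ring_1 list \<Rightarrow> 'a set \<Rightarrow> 'a set" where
  "lin_comb [] A = {0}"
| "lin_comb (x # xs) A = ideal_sum ((*) x ` A) (lin_comb xs A)"

lemma is_ideal_lin_comb: "is_ideal A \<Longrightarrow> is_ideal (lin_comb xs A)"
  by (induction xs) (auto intro: is_ideal_sum is_ideal_image)

lemma lin_comb_mono: "A \<subseteq> B \<Longrightarrow> lin_comb xs A \<subseteq> lin_comb xs B"
  by (induction xs) (simp_all add: ideal_sum_mono image_mono)

lemma lin_comb_ConsI: "a \<in> A \<Longrightarrow> s \<in> lin_comb xs A \<Longrightarrow> x * a + s \<in> lin_comb (x # xs) A"
  by (simp add: ideal_sumI)

lemma lin_comb_ConsE: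
  assumes "z \<in> lin_comb (x # xs) A"
  obtains a s where "z = x * a + s" "a \<in> A" "s \<in> lin_comb xs A"
  using assms by (auto elim!: ideal_sumE)

lemma lin_comb_Cons_upper: "is_ideal A \<Longrightarrow> lin_comb xs A \<subseteq> lin_comb (x # xs) A"
  using ideal_sum_upper2[OF is_ideal_image] by simp

lemma lin_comb_mult:
  assumes "s \<in> lin_comb xs A" "\<And>a. a \<in> A \<Longrightarrow> y * a \<in> B"
  shows "y * s \<in> lin_comb xs B"
  using assms(1)
proof (induction xs arbitrary: s)
  case (Cons x xs)
  then obtain a t where "s = x * a + t" "a \<in> A" "t \<in> lin_comb xs A" by (metis lin_comb_ConsE)
  then have "x * (y * a) + y * t \<in> lin_comb (x # xs) B" using Cons.IH assms(2) lin_comb_ConsI by blast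
  then show ?case using \<open>s = x * a + t\<close> by (simp add: algebra_simps)
qed simp

lemma lin_comb_least:
  assumes "is_ideal B" "\<And>x a. x \<in> set xs \<Longrightarrow> a \<in> A \<Longrightarrow> x * a \<in> B"
  shows "lin_comb xs A \<subseteq> B"
  using assms(2)
proof (induction xs)
  case Nil
  then show ?case using assms(1) ideal_zero by auto
next
  case (Cons x xs)
  then have "(*) x ` A \<subseteq> B" "lin_comb xs A \<subseteq> B" by auto
  then show ?case using ideal_sum_least[OF assms(1)] by simp
qed

lemma mult_in_lin_comb:
  assumes A: "is_ideal A" and "x \<in> set xs" "a \<in> A"
  shows "x * a \<in> lin_comb xs A"
  using assms(2)
proof (induction xs)
  case (Cons y xs)
  show ?case
  proof (cases "x = y")
    case True
    then show ?thesis
      using lin_comb_ConsI[OF assms(3) ideal_zero[OF is_ideal_lin_comb[OF A]], of x xs] by simp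
  next
    case False
    then show ?thesis using Cons lin_comb_Cons_upper[OF A, of xs y] by auto
  qed
qed simp

lemma is_ideal_gen_ideal: "is_ideal (gen_ideal S)"
  by (auto simp: gen_ideal_def is_ideal_def)

lemma gen_ideal_upper: "S \<subseteq> gen_ideal S"
  by (auto simp: gen_ideal_def)

lemma gen_ideal_least: "is_ideal B \<Longrightarrow> S \<subseteq> B \<Longrightarrow> gen_ideal S \<subseteq> B"
  by (auto simp: gen_ideal_def)

lemma ideal_prod_gen_ideal:
  assumes A: "is_ideal A"
  shows "ideal_prod (gen_ideal (set xs)) A = lin_comb xs A"
proof
  have "a * b \<in> lin_comb xs A" if a: "a \<in> gen_ideal (set xs)" and b: "b \<in> A" for a b
  proof -
    have "gen_ideal (set xs) \<subseteq> colon (lin_comb xs A) UNIV b"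
      using mult_in_lin_comb[OF A _ b]
      by (intro gen_ideal_least is_ideal_colon is_ideal_lin_comb A is_ideal_UNIV)
        (auto simp: colon_def mult.commute)
    then show ?thesis using a by (auto simp: colon_def mult.commute)
  qed
  then show "ideal_prod (gen_ideal (set xs)) A \<subseteq> lin_comb xs A"
    unfolding ideal_prod_def by (intro gen_ideal_least is_ideal_lin_comb A) auto
  show "lin_comb xs A \<subseteq> ideal_prod (gen_ideal (set xs)) A"
  proof (rule lin_comb_least)
    show "is_ideal (ideal_prod (gen_ideal (set xs)) A)" by (simp add: ideal_prod_def is_ideal_gen_ideal)
    fix x a assume "x \<in> set xs" "a \<in> A"
    then have "x \<in> gen_ideal (set xs)" using gen_ideal_upper[of "set xs"] by blast
    then show "x * a \<in> ideal_prod (gen_ideal (set xs)) A"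
      unfolding ideal_prod_def using \<open>a \<in> A\<close> by (intro gen_ideal_upper[THEN subsetD]) blast
  qed
qed

lemma gen_ideal_eq_lin_comb: "gen_ideal (set xs) = lin_comb xs UNIV"
proof
  show "gen_ideal (set xs) \<subseteq> lin_comb xs UNIV"
    using mult_in_lin_comb[OF is_ideal_UNIV, of _ xs 1]
    by (intro gen_ideal_least is_ideal_lin_comb is_ideal_UNIV) auto
  show "lin_comb xs UNIV \<subseteq> gen_ideal (set xs)"
    using gen_ideal_upper[of "set xs"]
    by (intro lin_comb_least is_ideal_gen_ideal) (auto intro: ideal_mult_right[OF is_ideal_gen_ideal])
qed

text \<open>The regular sequence is read from the end of the list.\<close>
primrec rev_regular :: "'a::comm_ring_1 list \<Rightarrow> bool" where
  "rev_regular [] \<longleftrightarrow> True"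
| "rev_regular (x # xs) \<longleftrightarrow> regular_on (lin_comb xs UNIV) x \<and> rev_regular xs"

lemma rev_regular_if_regseq: "regseq m xs {0} \<Longrightarrow> rev_regular (rev xs)"
proof (induction xs rule: rev_induct)
  case (snoc x xs)
  then show ?case
    by (simp add: regseq_append adjoin_list_eq_gen_ideal flip: gen_ideal_eq_lin_comb)
qed simp

text \<open>The shift to \<open>Suc k\<close> keeps indices natural, so \<open>k < n\<close> covers
  the degrees 1 to \<open>n\<close>. Only one inclusion is demanded; the other holds once the
  \<open>xs\<close> map each ideal \<open>F k\<close> into \<open>F (Suc k)\<close>.\<close>

definition standard :: "'a::comm_ring_1 list \<Rightarrow> (nat \<Rightarrow> 'a set) \<Rightarrow> nat \<Rightarrow> bool" where
  "standard xs F n \<longleftrightarrow> (\<forall>k<n. lin_comb xs UNIV \<inter> F (Suc k) \<subseteq> lin_comb xs (F k))"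

lemma standardD:
  "standard xs F n \<Longrightarrow> k < n \<Longrightarrow> a \<in> lin_comb xs UNIV \<Longrightarrow> a \<in> F (Suc k) \<Longrightarrow> a \<in> lin_comb xs (F k)"
  unfolding standard_def by blast

text \<open>In \<open>a = x b + s\<close> the term \<open>x b\<close> lies in \<open>(xs)\<close>,
  so \<open>b\<close> does by regularity. As \<open>b\<close> is also in \<open>F (Suc k)\<close>,
  the induction hypothesis puts it into \<open>(xs) F k\<close>, and the factor \<open>x\<close>
  turns this into \<open>(xs) F (Suc k)\<close>.\<close>

lemma standard_Cons:
  assumes F: "F 0 = UNIV" "\<And>k. is_ideal (F k)" "\<And>k a. a \<in> F k \<Longrightarrow> x * a \<in> F (Suc k)"
    and reg: "regular_on (lin_comb xs UNIV) x" and std: "standard (x # xs) F n"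
  shows "standard xs F n"
proof -
  have "a \<in> lin_comb xs (F k)" if "k < n" "a \<in> lin_comb xs UNIV" "a \<in> F (Suc k)" for k a
    using that
  proof (induction k arbitrary: a)
    case 0
    then show ?case using F(1) by simp
  next
    case (Suc k)
    have "a \<in> lin_comb (x # xs) (F (Suc k))"
      using Suc.prems lin_comb_Cons_upper[OF is_ideal_UNIV, of xs x] by (intro standardD[OF std]) auto
    then obtain b s where bs: "a = x * b + s" "b \<in> F (Suc k)" "s \<in> lin_comb xs (F (Suc k))"
      by (rule lin_comb_ConsE)
    have "s \<in> lin_comb xs UNIV" using bs(3) lin_comb_mono[of "F (Suc k)" UNIV xs] by blast
    then have "a - s \<in> lin_comb xs UNIV"
      using Suc.prems(2) ideal_diff is_ideal_lin_comb[OF is_ideal_UNIV] by blast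
    then have "b \<in> lin_comb xs UNIV" using reg bs(1) by (simp add: regular_on_def)
    then have "b \<in> lin_comb xs (F k)" using Suc.IH bs(2) Suc.prems(1) by simp
    then have "x * b \<in> lin_comb xs (F (Suc k))" using lin_comb_mult F(3) by blast
    then show ?case using bs ideal_add is_ideal_lin_comb F(2) by blast
  qed
  then show ?thesis unfolding standard_def by blast
qed

text \<open>Functions on \<open>nat\<close> are extended by \<open>0\<close> to the negative integers, so \<open>nab f 0 = f 0\<close>.\<close>
definition nab :: "(nat \<Rightarrow> 'b::ab_group_add) \<Rightarrow> nat \<Rightarrow> 'b" where
  "nab f n = f n - (case n of 0 \<Rightarrow> 0 | Suc k \<Rightarrow> f k)"

lemma nab_simps [simp]: "nab f 0 = f 0" "nab f (Suc k) = f (Suc k) - f k"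
  by (simp_all add: nab_def)

text \<open>Telescoping: the summand is \<open>(nab ^^ j) f (Suc k)\<close> minus
  \<open>(nab ^^ Suc j) f (Suc k)\<close>.\<close>

lemma sum_nab_pow: "(\<Sum>j<d. (nab ^^ j) f k) = f (Suc k) - (nab ^^ d) f (Suc k)"
  by (induction d) simp_all

text \<open>Equivalently, \<open>x\<close> maps \<open>R/((xs) + F k)\<close> injectively into
  \<open>R/((xs) + F (Suc k))\<close>. Standardness rewrites the \<open>b\<close> in
  \<open>x r = a + b\<close> as \<open>x c\<close> with \<open>c\<close> in \<open>F k\<close>, up
  to \<open>(xs)\<close>; regularity of \<open>x\<close> then compares \<open>r\<close> with
  \<open>c\<close>.\<close>

lemma standard_colon:
  assumes F: "F 0 = UNIV" "\<And>k. is_ideal (F k)" "\<And>k a. a \<in> F k \<Longrightarrow> x * a \<in> F (Suc k)"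
    and reg: "regular_on (lin_comb xs UNIV) x" and std: "standard (x # xs) F n" and k: "Suc k \<le> n"
  shows "colon (ideal_sum (lin_comb xs UNIV) (F (Suc k))) UNIV x = ideal_sum (lin_comb xs UNIV) (F k)"
proof (intro equalityI subsetI)
  have idA: "is_ideal (lin_comb xs UNIV)" by (simp add: is_ideal_lin_comb)
  fix r assume "r \<in> colon (ideal_sum (lin_comb xs UNIV) (F (Suc k))) UNIV x"
  then have "x * r \<in> ideal_sum (lin_comb xs UNIV) (F (Suc k))" by (simp add: colon_def)
  then obtain a b where ab: "x * r = a + b" "a \<in> lin_comb xs UNIV" "b \<in> F (Suc k)"
    by (rule ideal_sumE)
  have "x * r + (- a) \<in> lin_comb (x # xs) UNIV"
    by (intro lin_comb_ConsI ideal_uminus[OF idA] ab UNIV_I)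
  then have "b \<in> lin_comb (x # xs) UNIV" using ab(1) by simp
  then have "b \<in> lin_comb (x # xs) (F k)" using standardD[OF std] k ab(3) by simp
  then obtain c s where cs: "b = x * c + s" "c \<in> F k" "s \<in> lin_comb xs (F k)"
    by (rule lin_comb_ConsE)
  have "s \<in> lin_comb xs UNIV" using cs(3) lin_comb_mono[of "F k" UNIV xs] by blast
  then have "a + s \<in> lin_comb xs UNIV" using ab ideal_add[OF idA] by blast
  moreover have "a + s = x * (r - c)" using ab cs by (simp add: algebra_simps)
  ultimately have "r - c \<in> lin_comb xs UNIV" using reg by (simp add: regular_on_def)
  from ideal_sumI[OF this cs(2)] show "r \<in> ideal_sum (lin_comb xs UNIV) (F k)" by simp
next
  fix r assume "r \<in> ideal_sum (lin_comb xs UNIV) (F k)"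
  then obtain a b where "r = a + b" "a \<in> lin_comb xs UNIV" "b \<in> F k" by (rule ideal_sumE)
  then show "r \<in> colon (ideal_sum (lin_comb xs UNIV) (F (Suc k))) UNIV x"
    using F(3) ideal_mult[OF is_ideal_lin_comb[OF is_ideal_UNIV], of a xs x]
    by (simp add: colon_def distrib_left ideal_sumI)
qed

text \<open>With \<open>A = (xs)\<close> and \<open>k > 0\<close>, multiplication by
  \<open>x\<close> embeds \<open>R/(A + F (k - 1))\<close> into \<open>R/(A + F k)\<close> with
  cokernel \<open>R/((x) + A + F k)\<close>, so each generator contributes one backward difference.
  For \<open>k = 0\<close> all quotients vanish, in accordance with
  \<open>nab f 0 = f 0\<close>.\<close>

lemma qlength_standard_quotient:
  assumes F: "F 0 = UNIV" "\<And>k. is_ideal (F k)" "\<And>k. fin_len UNIV (F k)"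
    and xF: "\<And>x k a. x \<in> set xs \<Longrightarrow> a \<in> F k \<Longrightarrow> x * a \<in> F (Suc k)"
    and reg: "rev_regular xs" and std: "standard xs F n" and k: "k \<le> n"
  shows "int (qlength UNIV (ideal_sum (lin_comb xs UNIV) (F k)))
    = (nab ^^ length xs) (\<lambda>k. int (qlength UNIV (F k))) k"
  using xF reg std k
proof (induction xs arbitrary: k)
  case Nil
  then show ?case by simp
next
  case (Cons x xs)
  let ?A = "lin_comb xs UNIV" and ?f = "\<lambda>k. int (qlength UNIV (F k))"
  have idA: "is_ideal ?A" by (simp add: is_ideal_lin_comb)
  have xF: "a \<in> F k \<Longrightarrow> x * a \<in> F (Suc k)" for a k using Cons.prems by simp
  have reg: "regular_on ?A x" using Cons.prems by simp
  have std: "standard xs F n" using standard_Cons[OF F(1,2) xF reg] Cons.prems by simp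
  have IH: "int (qlength UNIV (ideal_sum ?A (F k))) = (nab ^^ length xs) ?f k" if "k \<le> n" for k
    using Cons.IH[OF _ _ std that] Cons.prems by simp
  show ?case
  proof (cases k)
    case 0
    then show ?thesis using IH[of 0] F(1)
      by (simp add: ideal_sum_UNIV is_ideal_lin_comb is_ideal_sum is_ideal_image)
  next
    case (Suc k')
    let ?N = "ideal_sum ?A (F k)"
    have idN: "is_ideal ?N" using idA F(2) by (simp add: is_ideal_sum)
    have flN: "fin_len UNIV ?N"
      using F(3)[of k] idN ideal_sum_upper2[OF idA] by (rule fin_len_UNIV_mono)
    have "qlength UNIV ?N = qlength UNIV (ideal_sum ((*) x ` UNIV) ?N) + qlength (ideal_sum ((*) x ` UNIV) ?N) ?N"
      using flN is_ideal_sum[OF is_ideal_image[OF is_ideal_UNIV] idN]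
        ideal_sum_upper2[OF is_ideal_image[OF is_ideal_UNIV]] subset_UNIV by (rule qlength_split)
    moreover have "qlength (ideal_sum ((*) x ` UNIV) ?N) ?N = qlength UNIV (ideal_sum ?A (F k'))"
      using qlength_mult[OF is_ideal_UNIV idN, of x] standard_colon[OF F(1,2) xF reg, of n k'] Cons.prems Suc
      by simp
    ultimately show ?thesis using IH[of k] IH[of k'] Cons.prems(4) Suc
      by (simp add: ideal_sum_assoc)
  qed
qed

text \<open>With \<open>A = (xs)\<close>, the ideal \<open>K = x F k + A\<close> is inserted between
  \<open>L = x F k + (xs) F k\<close> and \<open>M = (x) + A\<close>. The quotient
  \<open>M/K\<close> is a copy of \<open>R/(A + F k)\<close>, whose length is the new difference;
  \<open>K/L\<close> is a copy of \<open>A/(xs) F k\<close>, the inductive case.\<close>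

lemma qlength_standard_product:
  assumes F: "F 0 = UNIV" "\<And>k. is_ideal (F k)" "\<And>k. fin_len UNIV (F k)"
    and xF: "\<And>x k a. x \<in> set xs \<Longrightarrow> a \<in> F k \<Longrightarrow> x * a \<in> F (Suc k)"
    and reg: "rev_regular xs" and std: "standard xs F n" and k: "k \<le> n"
  shows "fin_len (lin_comb xs UNIV) (lin_comb xs (F k)) \<and>
    int (qlength (lin_comb xs UNIV) (lin_comb xs (F k)))
      = (\<Sum>j<length xs. (nab ^^ j) (\<lambda>k. int (qlength UNIV (F k))) k)"
  using xF reg std
proof (induction xs)
  case Nil
  then show ?case by (simp add: fin_len_refl qlength_refl)
next
  case (Cons x xs)
  let ?A = "lin_comb xs UNIV" and ?B = "lin_comb xs (F k)"
  have idA: "is_ideal ?A" and idB: "is_ideal ?B" using F by (simp_all add: is_ideal_lin_comb)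
  have BA: "?B \<subseteq> ?A" by (rule lin_comb_mono) simp
  have xF: "a \<in> F k \<Longrightarrow> x * a \<in> F (Suc k)" for a k using Cons.prems by simp
  have reg: "regular_on ?A x" using Cons.prems by simp
  have std: "standard xs F n" using standard_Cons[OF F(1,2) xF reg] Cons.prems by simp
  note IH = Cons.IH[OF Cons.prems(1) _ std]
  \<comment> \<open>Standardness is used one degree lower: \<open>b\<close> lies in
    \<open>(xs) F (k - 1)\<close>, and the factor \<open>x\<close> restores the degree. This is why
    \<open>?A\<close> meets \<open>?L\<close> only in \<open>?B\<close>.\<close>
  have xB: "x * b \<in> ?B" if b: "b \<in> F k" "b \<in> ?A" for b
  proof (cases k)
    case 0
    then show ?thesis using b F(1) idA ideal_mult by simp
  next
    case (Suc k')
    then have "b \<in> lin_comb xs (F k')" using standardD[OF std] b k by simp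
    then show ?thesis using Suc lin_comb_mult xF by blast
  qed
  let ?L = "lin_comb (x # xs) (F k)" and ?K = "ideal_sum ((*) x ` F k) ?A" and ?M = "lin_comb (x # xs) UNIV"
  have idL: "is_ideal ?L" and idM: "is_ideal ?M" using F by (simp_all add: is_ideal_lin_comb is_ideal_sum is_ideal_image)
  have idK: "is_ideal ?K" using F idA by (intro is_ideal_sum is_ideal_image)
  \<comment> \<open>With multiplier 1 the multiplication isomorphism becomes the second isomorphism
    theorem for \<open>(?A + ?L)/?L\<close>.\<close>
  have "colon ?L ?A 1 = ?B"
  proof (intro equalityI subsetI)
    fix r assume "r \<in> colon ?L ?A 1"
    then have r: "r \<in> ?A" "r \<in> ?L" by (simp_all add: colon_def)
    then obtain b s where bs: "r = x * b + s" "b \<in> F k" "s \<in> ?B" by (metis lin_comb_ConsE)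
    then have "x * b \<in> ?A" using r(1) BA idA ideal_diff[of ?A r s] by auto
    then have "b \<in> ?A" using reg by (simp add: regular_on_def)
    then show "r \<in> ?B" using bs xB idB ideal_add by blast
  next
    fix r assume "r \<in> ?B"
    then show "r \<in> colon ?L ?A 1" using BA lin_comb_Cons_upper[OF F(2), of xs k x] by (auto simp: colon_def)
  qed
  moreover have "ideal_sum ((*) 1 ` ?A) ?L = ?K"
  proof -
    have "ideal_sum ((*) 1 ` ?A) ?L = ideal_sum ((*) x ` F k) (ideal_sum ?B ?A)"
      by (simp add: ideal_sum_assoc ideal_sum_commute[of ?A])
    moreover have "ideal_sum ?B ?A = ?A"
      by (intro equalityI ideal_sum_least ideal_sum_upper2 idA idB BA subset_refl)
    ultimately show ?thesis by simp
  qed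
  ultimately have lower: "fin_len ?K ?L \<longleftrightarrow> fin_len ?A ?B" "qlength ?K ?L = qlength ?A ?B"
    using fin_len_mult[OF idA idL, of 1] qlength_mult[OF idA idL, of 1] by simp_all
  have "colon ?K UNIV x = ideal_sum ?A (F k)"
  proof (intro equalityI subsetI)
    fix r assume "r \<in> colon ?K UNIV x"
    then have "x * r \<in> ?K" by (simp add: colon_def)
    then obtain b a where ab: "x * r = x * b + a" "b \<in> F k" "a \<in> ?A" by (auto elim!: ideal_sumE)
    then have "x * (r - b) \<in> ?A" by (simp add: algebra_simps)
    then have "r - b \<in> ?A" using reg by (simp add: regular_on_def)
    from ideal_sumI[OF this ab(2)] show "r \<in> ideal_sum ?A (F k)" by simp
  next
    fix r assume "r \<in> ideal_sum ?A (F k)"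
    then obtain a b where "r = a + b" "a \<in> ?A" "b \<in> F k" by (rule ideal_sumE)
    then have "x * r = x * b + x * a" "x * a \<in> ?A" using ideal_mult[OF idA, of a x] by (simp_all add: algebra_simps)
    then show "r \<in> colon ?K UNIV x" using \<open>b \<in> F k\<close> by (auto simp: colon_def intro!: ideal_sumI)
  qed
  moreover have "ideal_sum ((*) x ` UNIV) ?K = ?M"
  proof -
    have "ideal_sum ((*) x ` UNIV) ((*) x ` F k) = (*) x ` UNIV"
      by (intro equalityI ideal_sum_least ideal_sum_upper1 is_ideal_image is_ideal_UNIV F image_mono) auto
    then show ?thesis by (simp flip: ideal_sum_assoc)
  qed
  ultimately have upper: "fin_len ?M ?K \<longleftrightarrow> fin_len UNIV (ideal_sum ?A (F k))"
      "qlength ?M ?K = qlength UNIV (ideal_sum ?A (F k))"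
    using fin_len_mult[OF is_ideal_UNIV idK, of x] qlength_mult[OF is_ideal_UNIV idK, of x] by simp_all
  have "fin_len UNIV (ideal_sum ?A (F k))"
    using F(3) is_ideal_sum[OF idA F(2)] ideal_sum_upper2[OF idA] by (rule fin_len_UNIV_mono)
  moreover have "int (qlength UNIV (ideal_sum ?A (F k))) = (nab ^^ length xs) (\<lambda>k. int (qlength UNIV (F k))) k"
    using Cons.prems by (intro qlength_standard_quotient[OF F _ _ std k]) simp_all
  moreover have "fin_len ?A ?B" "int (qlength ?A ?B) = (\<Sum>j<length xs. (nab ^^ j) (\<lambda>k. int (qlength UNIV (F k))) k)"
    using IH Cons.prems by simp_all
  ultimately show ?case
    using fin_len_trans[of ?M ?K ?L] qlength_additive[of ?M ?K ?L] lower upper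
    by (simp del: lin_comb.simps)
qed

subsection \<open>Numerical polynomials\<close>

definition sh :: "(nat \<Rightarrow> 'b::ab_group_add) \<Rightarrow> nat \<Rightarrow> 'b" where
  "sh f n = (case n of 0 \<Rightarrow> 0 | Suc k \<Rightarrow> f k)"

lemma sh_simps [simp]: "sh f 0 = 0" "sh f (Suc k) = f k"
  by (simp_all add: sh_def)

lemma nab_pow_sh: "(nab ^^ d) (sh f) = sh ((nab ^^ d) f)"
proof (induction d)
  case (Suc d)
  have "nab (sh g) = sh (nab g)" for g :: "nat \<Rightarrow> 'a"
  proof
    show "nab (sh g) n = sh (nab g) n" for n
      by (cases n; cases "n - 1") auto
  qed
  then show ?case using Suc by simp
qed simp

lemma nab_pow_add: "(nab ^^ d) (\<lambda>n. f n + g n) = (\<lambda>n. (nab ^^ d) f n + (nab ^^ d) g n)"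
proof (induction d)
  case (Suc d)
  show ?case
  proof
    show "(nab ^^ Suc d) (\<lambda>n. f n + g n) n = (nab ^^ Suc d) f n + (nab ^^ Suc d) g n" for n
      by (cases n) (simp_all add: Suc)
  qed
qed simp

lemma nab_pow_diff: "(nab ^^ d) (\<lambda>n. f n - g n) = (\<lambda>n. (nab ^^ d) f n - (nab ^^ d) g n)"
proof (induction d)
  case (Suc d)
  show ?case
  proof
    show "(nab ^^ Suc d) (\<lambda>n. f n - g n) n = (nab ^^ Suc d) f n - (nab ^^ Suc d) g n" for n
      by (cases n) (simp_all add: Suc)
  qed
qed simp

lemma nab_pow_scale: "(nab ^^ d) (\<lambda>n. c * f n) = (\<lambda>n. (c :: int) * (nab ^^ d) f n)"
proof (induction d)
  case (Suc d)
  show ?case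
  proof
    show "(nab ^^ Suc d) (\<lambda>n. c * f n) n = c * (nab ^^ Suc d) f n" for n
      by (cases n) (simp_all add: Suc right_diff_distrib)
  qed
qed simp

lemma nab_pow_cong:
  assumes "\<And>n. n \<ge> N \<Longrightarrow> f n = g n" "n \<ge> N + d"
  shows "(nab ^^ d) f n = (nab ^^ d) g n"
  using assms(2)
proof (induction d arbitrary: n)
  case 0
  then show ?case using assms(1) by simp
next
  case (Suc d)
  then obtain k where k: "n = Suc k" "k \<ge> N + d" by (metis Suc_le_D add_Suc_right not_less_eq_eq)
  then show ?case using Suc.IH[of k] Suc.IH[of n] by simp
qed

text \<open>Eventually a polynomial of degree less than \<open>d\<close>.\<close>
definition num_poly :: "nat \<Rightarrow> (nat \<Rightarrow> int) \<Rightarrow> bool" where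
  "num_poly d f \<longleftrightarrow> (\<exists>N. \<forall>n\<ge>N. (nab ^^ d) f n = 0)"

lemma num_poly_Suc:
  assumes "num_poly d f" shows "num_poly (Suc d) f"
proof -
  obtain N where N: "\<forall>n\<ge>N. (nab ^^ d) f n = 0" using assms by (auto simp: num_poly_def)
  have "(nab ^^ Suc d) f n = 0" if "n \<ge> Suc N" for n
    using that N by (cases n) simp_all
  then show ?thesis unfolding num_poly_def by blast
qed

lemma num_poly_mono: "num_poly d f \<Longrightarrow> d \<le> e \<Longrightarrow> num_poly e f"
  by (rule dec_induct[of d e "\<lambda>e. num_poly e f"]) (auto intro: num_poly_Suc)

lemma num_poly_add:
  assumes "num_poly d f" "num_poly d g" shows "num_poly d (\<lambda>n. f n + g n)"
proof -
  obtain N M where "\<forall>n\<ge>N. (nab ^^ d) f n = 0" "\<forall>n\<ge>M. (nab ^^ d) g n = 0"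
    using assms by (auto simp: num_poly_def)
  then show ?thesis unfolding num_poly_def nab_pow_add by (intro exI[of _ "max N M"]) auto
qed

lemma num_poly_scale: "num_poly d f \<Longrightarrow> num_poly d (\<lambda>n. c * f n)"
  by (auto simp: num_poly_def nab_pow_scale)

lemma num_poly_sum: "finite S \<Longrightarrow> (\<And>i. i \<in> S \<Longrightarrow> num_poly d (f i)) \<Longrightarrow> num_poly d (\<lambda>n. \<Sum>i\<in>S. f i n)"
proof (induction S rule: finite_induct)
  case empty
  have "num_poly 0 (\<lambda>_. 0)" by (simp add: num_poly_def)
  then show ?case using num_poly_mono by auto
next
  case (insert x S)
  then show ?case using num_poly_add by simp
qed

lemma num_poly_sh:
  assumes "num_poly d f" shows "num_poly d (sh f)"
proof -
  obtain N where N: "\<forall>n\<ge>N. (nab ^^ d) f n = 0" using assms by (auto simp: num_poly_def)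
  have "sh ((nab ^^ d) f) n = 0" if "n \<ge> Suc N" for n using that N by (cases n) simp_all
  then show ?thesis unfolding num_poly_def nab_pow_sh by blast
qed

lemma num_poly_partial_sums:
  assumes "num_poly d f" shows "num_poly (Suc d) (\<lambda>n. \<Sum>i\<le>n. f i)"
proof -
  have "nab (\<lambda>n. \<Sum>i\<le>n. f i) = f"
  proof
    show "nab (\<lambda>n. \<Sum>i\<le>n. f i) n = f n" for n by (cases n) simp_all
  qed
  then show ?thesis using assms by (simp add: num_poly_def funpow_swap1)
qed

section \<open>Binomial expansions and leading coefficients\<close>

abbreviation binom_fun :: "nat \<Rightarrow> nat \<Rightarrow> int" where
  "binom_fun j n \<equiv> int ((n + j) choose j)"

lemma nab_binom_fun: "nab (binom_fun (Suc j)) = binom_fun j"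
proof
  show "nab (binom_fun (Suc j)) n = binom_fun j n" for n
    by (cases n) (simp_all add: algebra_simps)
qed

lemma nab_pow_binom_fun: "(nab ^^ j) (binom_fun j) = (\<lambda>_. 1)"
proof (induction j)
  case (Suc j)
  then show ?case by (simp only: funpow_Suc_right comp_apply nab_binom_fun)
qed simp

lemma num_poly_binom_fun: "j < d \<Longrightarrow> num_poly d (binom_fun j)"
proof -
  have "(nab ^^ Suc j) (binom_fun j) n = 0" if "n \<ge> 1" for n
    using that by (cases n) (simp_all add: nab_pow_binom_fun)
  then have "num_poly (Suc j) (binom_fun j)" unfolding num_poly_def by blast
  then show "j < d \<Longrightarrow> num_poly d (binom_fun j)" using num_poly_mono by auto
qed

lemma num_poly_eventually_const:
  assumes "num_poly (Suc d) f"
  shows "\<exists>e N. \<forall>n\<ge>N. (nab ^^ d) f n = e"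
proof -
  obtain N where N: "\<forall>n\<ge>N. (nab ^^ Suc d) f n = 0" using assms by (auto simp: num_poly_def)
  define e where "e = (nab ^^ d) f N"
  have const: "(nab ^^ d) f n = e" if "n \<ge> N" for n
    using that
  proof (induction n rule: dec_induct)
    case (step n)
    then show ?case using N[rule_format, of "Suc n"] by simp
  qed (simp add: e_def)
  then show ?thesis by blast
qed

lemma num_poly_binom_expansion:
  assumes "num_poly d f"
  shows "\<exists>c N. \<forall>n\<ge>N. f n = (\<Sum>j<d. c j * binom_fun j n)"
  using assms
proof (induction d arbitrary: f)
  case 0
  then show ?case by (simp add: num_poly_def)
next
  case (Suc d)
  then obtain e N where const: "\<forall>n\<ge>N. (nab ^^ d) f n = e"
    using num_poly_eventually_const by blast
  have "num_poly d (\<lambda>n. f n - e * binom_fun d n)"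
    unfolding num_poly_def nab_pow_diff nab_pow_scale nab_pow_binom_fun
    using const by (intro exI[of _ N]) simp
  then obtain c M where "\<forall>n\<ge>M. f n - e * binom_fun d n = (\<Sum>j<d. c j * binom_fun j n)"
    using Suc.IH by blast
  then have "\<forall>n\<ge>M. f n = (\<Sum>j<Suc d. (c(d := e)) j * binom_fun j n)"
    by (simp add: algebra_simps)
  then show ?case by blast
qed

lemma hs_sum_reindex:
  "(\<Sum>i=0..d. (-1) ^ i * es i * int ((n + d - i) choose (d - i)))
    = (\<Sum>j<d. ((-1) ^ (d - j) * es (d - j)) * binom_fun j n) + es 0 * binom_fun d n"
proof -
  have "(\<Sum>i=0..d. (-1) ^ i * es i * int ((n + d - i) choose (d - i)))
    = (\<Sum>j\<le>d. ((-1) ^ (d - j) * es (d - j)) * binom_fun j n)"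
    by (rule sum.reindex_bij_witness[of _ "\<lambda>j. d - j" "\<lambda>i. d - i"]) auto
  then show ?thesis by (simp flip: lessThan_Suc_atMost)
qed

text \<open>Evaluates the \<open>THE\<close> in \<open>hs_mult\<close>. The \<open>d\<close>-th
  difference eventually kills the binomials below \<open>d\<close> and is 1 on the top one, so it
  reads off the leading coefficient; conversely, an eventually constant \<open>d\<close>-th
  difference yields an expansion.\<close>

lemma hs_coefficient:
  fixes f :: "nat \<Rightarrow> int"
  assumes "\<forall>n\<ge>N. (nab ^^ d) f n = e"
  shows "(THE e. \<exists>es :: nat \<Rightarrow> int. es 0 = e \<and>
     (\<exists>N. \<forall>n\<ge>N. f n = (\<Sum>i=0..d. (-1) ^ i * es i * int ((n + d - i) choose (d - i))))) = e"
proof (rule the_equality)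
  show "\<exists>es :: nat \<Rightarrow> int. es 0 = e \<and>
     (\<exists>N. \<forall>n\<ge>N. f n = (\<Sum>i=0..d. (-1) ^ i * es i * int ((n + d - i) choose (d - i))))"
  proof -
    have "num_poly d (\<lambda>n. f n - e * binom_fun d n)"
      unfolding num_poly_def nab_pow_diff nab_pow_scale nab_pow_binom_fun
      using assms by (intro exI[of _ N]) simp
    then obtain c M where c: "\<forall>n\<ge>M. f n - e * binom_fun d n = (\<Sum>j<d. c j * binom_fun j n)"
      using num_poly_binom_expansion by blast
    \<comment> \<open>The factor \<open>(-1) ^ i\<close> cancels the alternating sign built into the
      Hilbert-Samuel polynomial.\<close>
    let ?es = "\<lambda>i. if i = 0 then e else (-1) ^ i * c (d - i)"
    have "f n = (\<Sum>i=0..d. (-1) ^ i * ?es i * int ((n + d - i) choose (d - i)))" if "n \<ge> M" for n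
    proof -
      have "(\<Sum>j<d. ((-1) ^ (d - j) * ?es (d - j)) * binom_fun j n) = (\<Sum>j<d. c j * binom_fun j n)"
        by (intro sum.cong refl) (simp flip: mult.assoc power_add mult_2)
      then show ?thesis using c[rule_format, OF that] by (simp only: hs_sum_reindex) simp
    qed
    then show ?thesis by (intro exI[of _ ?es]) auto
  qed
next
  fix e' assume "\<exists>es :: nat \<Rightarrow> int. es 0 = e' \<and>
     (\<exists>N. \<forall>n\<ge>N. f n = (\<Sum>i=0..d. (-1) ^ i * es i * int ((n + d - i) choose (d - i))))"
  then obtain es :: "nat \<Rightarrow> int" and M where es: "es 0 = e'"
    "\<forall>n\<ge>M. f n = (\<Sum>i=0..d. (-1) ^ i * es i * int ((n + d - i) choose (d - i)))" by blast
  let ?c = "\<lambda>j. (-1) ^ (d - j) * es (d - j)"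
  have f: "f n = (\<Sum>j<d. ?c j * binom_fun j n) + e' * binom_fun d n" if "n \<ge> M" for n
    using es that by (simp only: hs_sum_reindex)
  have "num_poly d (\<lambda>n. \<Sum>j<d. ?c j * binom_fun j n)"
    by (intro num_poly_sum num_poly_scale num_poly_binom_fun) auto
  then obtain K where K: "\<forall>n\<ge>K. (nab ^^ d) (\<lambda>n. \<Sum>j<d. ?c j * binom_fun j n) n = 0"
    by (auto simp: num_poly_def)
  let ?n = "max N (max K (M + d))"
  have "(nab ^^ d) f ?n = (nab ^^ d) (\<lambda>n. (\<Sum>j<d. ?c j * binom_fun j n) + e' * binom_fun d n) ?n"
    by (rule nab_pow_cong[of M]) (use f in auto)
  also have "\<dots> = e'"
    unfolding nab_pow_add nab_pow_scale nab_pow_binom_fun using K by simp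
  finally show "e' = e" using assms by simp
qed

lemma eventually_negative_if_nab:
  assumes "\<forall>n\<ge>N. (nab ^^ d) h n \<le> (-1 :: int)"
  shows "\<exists>N. \<forall>n\<ge>N. h n \<le> -1"
  using assms
proof (induction d arbitrary: N)
  case 0
  then show ?case by auto
next
  case (Suc d)
  let ?g = "(nab ^^ d) h"
  note step = Suc.prems[rule_format]
  have desc: "?g (N + k) \<le> ?g N - int k" for k
  proof (induction k)
    case (Suc k)
    then show ?case using step[of "Suc (N + k)"] by simp
  qed simp
  have "?g n \<le> -1" if "n \<ge> N + nat (\<bar>?g N\<bar> + 1)" for n
    using desc[of "n - N"] that by auto
  then show ?case using Suc.IH by blast
qed

text \<open>Turns a pointwise inequality of length functions into one of leading coefficients: a
  negative limiting difference would drive \<open>h\<close> below zero after \<open>d\<close>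
  summations.\<close>

lemma nab_limit_nonneg:
  assumes "\<forall>n\<ge>N. (nab ^^ d) h n = (c :: int)" "\<forall>n\<ge>M. h n \<ge> 0"
  shows "c \<ge> 0"
proof (rule ccontr)
  assume "\<not> c \<ge> 0"
  then have "\<forall>n\<ge>N. (nab ^^ d) h n \<le> -1" using assms(1) by auto
  then obtain K where "\<forall>n\<ge>K. h n \<le> -1" using eventually_negative_if_nab by blast
  then have "h (max K M) \<le> -1" "h (max K M) \<ge> 0" using assms(2) by auto
  then show False by simp
qed

text \<open>As \<open>f 0 = 0\<close>, this is the \<open>(d-1)\<close>-st difference of the
  increments, with the coefficients of \<open>(1 - t)^(d-1)\<close>. Taking \<open>gchoose\<close>
  at \<open>real d - 1\<close> covers \<open>d = 0\<close>, where the signed coefficients are all 1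
  and the sum telescopes; the step in \<open>d\<close> is Pascal's rule.\<close>

lemma nab_pow_gbinomial:
  fixes f :: "nat \<Rightarrow> real"
  assumes "f 0 = 0"
  shows "(nab ^^ d) f (Suc k) = (\<Sum>i=0..k. (-1) ^ i * ((real d - 1) gchoose i) * (f (Suc (k - i)) - f (k - i)))"
proof (induction d arbitrary: k)
  case 0
  have "(-1::real) ^ i * ((-1) gchoose i) = 1" for i
    by (simp add: gbinomial_minus[of 1 i, simplified] flip: power_mult_distrib binomial_gbinomial)
  then have "(\<Sum>i=0..k. (-1) ^ i * ((real 0 - 1) gchoose i) * (f (Suc (k - i)) - f (k - i)))
    = (\<Sum>i=0..k. f (Suc (k - i)) - f (k - i))" by simp
  also have "\<dots> = (\<Sum>i\<le>k. f (Suc i) - f i)"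
    by (rule sum.reindex_bij_witness[of _ "\<lambda>j. k - j" "\<lambda>i. k - i"]) auto
  also have "\<dots> = f (Suc k)" using assms by (induction k) auto
  finally show ?case by simp
next
  case (Suc d)
  let ?a = "real d - 1" and ?g = "\<lambda>i. f (Suc i) - f i"
  show ?case
  proof (cases k)
    case 0
    have "(nab ^^ d) f 0 = 0" using assms by (induction d) auto
    then show ?thesis using Suc.IH[of 0] 0 by simp
  next
    case (Suc k')
    have pascal: "(real (Suc d) - 1) gchoose (Suc i) = (?a gchoose i) + (?a gchoose (Suc i))" for i
      using gbinomial_Suc_Suc[of ?a i] by (simp add: add.commute)
    have "(\<Sum>i=0..k. (-1) ^ i * ((real (Suc d) - 1) gchoose i) * ?g (k - i))
      = ?g k + (\<Sum>i=0..k'. (-1) ^ Suc i * ((real (Suc d) - 1) gchoose (Suc i)) * ?g (k' - i))"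
      by (simp add: Suc sum.atLeast0_atMost_Suc_shift del: sum.cl_ivl_Suc)
    also have "\<dots> = (?g k + (\<Sum>i=0..k'. (-1) ^ Suc i * (?a gchoose (Suc i)) * ?g (k' - i)))
        - (\<Sum>i=0..k'. (-1) ^ i * (?a gchoose i) * ?g (k' - i))"
    proof -
      have "(-1) ^ Suc i * ((real (Suc d) - 1) gchoose (Suc i)) * ?g (k' - i)
        = (-1) ^ Suc i * (?a gchoose (Suc i)) * ?g (k' - i) - (-1) ^ i * (?a gchoose i) * ?g (k' - i)" for i
        unfolding pascal by (simp add: algebra_simps)
      then show ?thesis by (simp only: sum_subtractf add_diff_eq)
    qed
    also have "?g k + (\<Sum>i=0..k'. (-1) ^ Suc i * (?a gchoose (Suc i)) * ?g (k' - i))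
      = (\<Sum>i=0..k. (-1) ^ i * (?a gchoose i) * ?g (k - i))"
      by (simp add: Suc sum.atLeast0_atMost_Suc_shift del: sum.cl_ivl_Suc)
    finally show ?thesis using Suc.IH[of k] Suc.IH[of k'] Suc by simp
  qed
qed

subsection \<open>The Hilbert function of a graded module\<close>

text \<open>The family \<open>M n / N n\<close> stands for a graded module over the polynomial ring in variables acting
  as the elements of \<open>xs\<close>, generated in degree \<open>0\<close>.\<close>
definition graded_gen :: "'a::comm_ring_1 list \<Rightarrow> (nat \<Rightarrow> 'a set) \<Rightarrow> (nat \<Rightarrow> 'a set) \<Rightarrow> bool" where
  "graded_gen xs M N \<longleftrightarrow> (\<forall>n. is_ideal (M n) \<and> is_ideal (N n) \<and> N n \<subseteq> M n \<and>
     (\<forall>x\<in>set xs. (\<forall>a\<in>M n. x * a \<in> M (Suc n)) \<and> (\<forall>a\<in>N n. x * a \<in> N (Suc n))) \<and>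
     M (Suc n) \<subseteq> ideal_sum (lin_comb xs (M n)) (N (Suc n)))"

lemma graded_genD:
  assumes "graded_gen xs M N"
  shows "is_ideal (M n)" "is_ideal (N n)" "N n \<subseteq> M n"
    "x \<in> set xs \<Longrightarrow> a \<in> M n \<Longrightarrow> x * a \<in> M (Suc n)"
    "x \<in> set xs \<Longrightarrow> a \<in> N n \<Longrightarrow> x * a \<in> N (Suc n)"
    "M (Suc n) \<subseteq> ideal_sum (lin_comb xs (M n)) (N (Suc n))"
  using assms unfolding graded_gen_def by simp_all

definition prev :: "(nat \<Rightarrow> 'a::comm_ring_1 set) \<Rightarrow> nat \<Rightarrow> 'a set" where
  "prev M n = (case n of 0 \<Rightarrow> {0} | Suc k \<Rightarrow> M k)"

lemma prev_simps [simp]: "prev M 0 = {0}" "prev M (Suc k) = M k"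
  by (simp_all add: prev_def)

text \<open>Multiplication by \<open>x\<^sup>t\<close> identifies \<open>M s / slice x M N t s\<close> with the degree \<open>s + t\<close> part of
  \<open>x\<^sup>t(M/N) / x\<^bsup>t+1\<^esup>(M/N)\<close>, a graded module on which \<open>x\<close> is no longer needed as a variable.\<close>
definition slice :: "'a::comm_ring_1 \<Rightarrow> (nat \<Rightarrow> 'a set) \<Rightarrow> (nat \<Rightarrow> 'a set) \<Rightarrow> nat \<Rightarrow> nat \<Rightarrow> 'a set" where
  "slice x M N t s = ideal_sum ((*) x ` prev M s) (colon (N (s + t)) (M s) (x ^ t))"

lemma sliceI:
  "a \<in> prev M s \<Longrightarrow> c \<in> M s \<Longrightarrow> x ^ t * c \<in> N (s + t) \<Longrightarrow> x * a + c \<in> slice x M N t s"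
  unfolding slice_def by (intro ideal_sumI) (auto simp: colon_def)

lemma sliceE:
  assumes "z \<in> slice x M N t s"
  obtains a c where "z = x * a + c" "a \<in> prev M s" "c \<in> M s" "x ^ t * c \<in> N (s + t)"
  using assms unfolding slice_def by (auto elim!: ideal_sumE simp: colon_def)

context
  fixes x :: "'a::comm_ring_1" and xs M N
  assumes gg: "graded_gen (x # xs) M N"
begin

lemma pow_mult_N: "b \<in> N n \<Longrightarrow> x ^ t * b \<in> N (n + t)"
proof (induction t)
  case (Suc t)
  then show ?case using graded_genD(5)[OF gg, of x "x ^ t * b" "n + t"] by (simp add: mult.assoc)
qed simp

lemma is_ideal_prev: "is_ideal (prev M s)"
  using graded_genD(1)[OF gg] by (cases s) simp_all

lemma mult_prev: "y \<in> set (x # xs) \<Longrightarrow> a \<in> prev M s \<Longrightarrow> y * a \<in> M s"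
  using graded_genD(4)[OF gg] ideal_zero[OF graded_genD(1)[OF gg]] by (cases s) simp_all

lemma is_ideal_slice: "is_ideal (slice x M N t s)"
  unfolding slice_def using graded_genD(1,2)[OF gg]
  by (intro is_ideal_sum is_ideal_image is_ideal_colon is_ideal_prev)

lemma slice_subset: "slice x M N t s \<subseteq> M s"
  using mult_prev[of x] graded_genD(1)[OF gg] by (auto elim!: sliceE intro!: ideal_add)

lemma N_subset_slice: "N s \<subseteq> slice x M N t s"
proof
  fix b assume b: "b \<in> N s"
  have "x * 0 + b \<in> slice x M N t s"
    using ideal_zero[OF is_ideal_prev] subsetD[OF graded_genD(3)[OF gg] b] pow_mult_N[OF b] by (rule sliceI)
  then show "b \<in> slice x M N t s" by simp
qed

lemma slice_step: "slice x M N t s \<subseteq> slice x M N (Suc t) s"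
proof
  fix z assume "z \<in> slice x M N t s"
  then obtain a c where z: "z = x * a + c" "a \<in> prev M s" "c \<in> M s" "x ^ t * c \<in> N (s + t)" by (rule sliceE)
  have "x ^ Suc t * c \<in> N (s + Suc t)"
    using graded_genD(5)[OF gg _ z(4), of x] by (simp add: mult.assoc)
  then show "z \<in> slice x M N (Suc t) s" using z sliceI by blast
qed

lemma slice_mono: "t \<le> t' \<Longrightarrow> slice x M N t s \<subseteq> slice x M N t' s"
proof (induction t' rule: dec_induct)
  case (step k)
  then show ?case using slice_step by blast
qed simp

lemma graded_gen_slice: "graded_gen xs M (slice x M N t)"
proof -
  have mult: "y * z \<in> slice x M N t (Suc s)" if y: "y \<in> set xs" and zs: "z \<in> slice x M N t s" for y z s
  proof -
    obtain a c where z: "z = x * a + c" "a \<in> prev M s" "c \<in> M s" "x ^ t * c \<in> N (s + t)"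
      using zs by (rule sliceE)
    have "y * a \<in> prev M (Suc s)" "y * c \<in> M (Suc s)"
      using mult_prev[of y] graded_genD(4)[OF gg] y z by simp_all
    moreover have "x ^ t * (y * c) \<in> N (Suc s + t)"
      using graded_genD(5)[OF gg _ z(4), of y] y by (simp add: mult.left_commute)
    ultimately have "x * (y * a) + y * c \<in> slice x M N t (Suc s)" by (rule sliceI)
    then show ?thesis using z(1) by (simp add: algebra_simps)
  qed
  have gen: "z \<in> ideal_sum (lin_comb xs (M n)) (slice x M N t (Suc n))" if zM: "z \<in> M (Suc n)" for z n
  proof -
    have "z \<in> ideal_sum (lin_comb (x # xs) (M n)) (N (Suc n))" using zM graded_genD(6)[OF gg] by blast
    then obtain u b where u: "z = u + b" "u \<in> lin_comb (x # xs) (M n)" "b \<in> N (Suc n)" by (rule ideal_sumE)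
    obtain a s where s: "u = x * a + s" "a \<in> M n" "s \<in> lin_comb xs (M n)" using u(2) by (rule lin_comb_ConsE)
    have "x * a + b \<in> slice x M N t (Suc n)"
      using s(2) subsetD[OF graded_genD(3)[OF gg] u(3)] pow_mult_N[OF u(3)] by (intro sliceI) simp_all
    then have "s + (x * a + b) \<in> ideal_sum (lin_comb xs (M n)) (slice x M N t (Suc n))"
      using s(3) by (intro ideal_sumI)
    then show ?thesis using u(1) s(1) by (simp add: algebra_simps)
  qed
  show ?thesis unfolding graded_gen_def
    using is_ideal_slice slice_subset mult gen graded_genD(1,4)[OF gg] by simp blast
qed

text \<open>An element \<open>r\<close> of \<open>N' n\<close> is divided by \<open>x\<close>
  repeatedly: modulo \<open>N n\<close> it is \<open>x^t a\<close> with \<open>a\<close> of degree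
  \<open>n - t\<close>, and the inclusion of slices allows \<open>a\<close> to be replaced by a
  multiple of \<open>x\<close>. The degree runs out after \<open>n\<close> steps.\<close>

lemma slice_reflects:
  assumes N': "\<And>n. N n \<subseteq> N' n" "\<And>n. N' n \<subseteq> M n" "\<And>n. is_ideal (N' n)"
    and le: "\<And>t s. slice x M N' t s \<subseteq> slice x M N t s"
  shows "N' n \<subseteq> N n"
proof
  fix r assume r: "r \<in> N' n"
  have step: "\<exists>a'\<in>prev M (n - t). r - x ^ Suc t * a' \<in> N n"
    if t: "t \<le> n" and a: "a \<in> M (n - t)" "r - x ^ t * a \<in> N n" for t a
  proof -
    have "r - (r - x ^ t * a) \<in> N' n" by (rule ideal_diff[OF N'(3) r subsetD[OF N'(1) a(2)]])
    then have "x ^ t * a \<in> N' n" by simp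
    then have "x * 0 + a \<in> slice x M N' t (n - t)"
      using a t ideal_zero[OF is_ideal_prev] by (intro sliceI) simp_all
    then have "a \<in> slice x M N t (n - t)" using le by auto
    then obtain a' c where c: "a = x * a' + c" "a' \<in> prev M (n - t)" "x ^ t * c \<in> N (n - t + t)" by (metis sliceE)
    have "(r - x ^ t * a) + x ^ t * c \<in> N n"
      using c(3) a(2) t graded_genD(2)[OF gg] by (intro ideal_add) simp_all
    moreover have "(r - x ^ t * a) + x ^ t * c = r - x ^ Suc t * a'" using c(1) by (simp add: algebra_simps)
    ultimately show ?thesis using c(2) by metis
  qed
  have "\<exists>a\<in>M (n - t). r - x ^ t * a \<in> N n" if "t \<le> n" for t
    using that
  proof (induction t)
    case 0
    then show ?case using r N' ideal_zero[OF graded_genD(2)[OF gg]] by (intro bexI[of _ r]) auto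
  next
    case (Suc t)
    then obtain a where "a \<in> M (n - t)" "r - x ^ t * a \<in> N n" by auto
    moreover have "n - t = Suc (n - Suc t)" using Suc.prems by simp
    ultimately show ?case using step[of t a] Suc.prems by simp
  qed
  then obtain a where "a \<in> M (n - n)" "r - x ^ n * a \<in> N n" by blast
  \<comment> \<open>In degree 0 the next quotient lies in \<open>prev M 0 = {0}\<close>, so
    \<open>r\<close> itself is in \<open>N n\<close>.\<close>
  then show "r \<in> N n" using step[of n a] by simp
qed

text \<open>Everything lives in degree \<open>s + t\<close>: raising the power of \<open>x\<close>
  by one lowers the degree taken from \<open>M\<close> by one. The colon ideal for
  \<open>x ^ t\<close> is the slice, which identifies the upper quotient.\<close>

lemma
  assumes fl: "\<And>n. fin_len (M n) (N n)"
  shows fin_len_slice: "fin_len (M s) (slice x M N t s)"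
    and qlength_slice_step:
      "qlength (ideal_sum ((*) (x ^ t) ` M s) (N (s + t))) (N (s + t))
        = qlength (M s) (slice x M N t s)
          + qlength (ideal_sum ((*) (x ^ Suc t) ` prev M s) (N (s + t))) (N (s + t))"
proof -
  show "fin_len (M s) (slice x M N t s)"
    by (rule fin_len_upper[OF fl is_ideal_slice N_subset_slice slice_subset])
  let ?N = "N (s + t)"
  let ?E = "ideal_sum ((*) (x ^ t) ` M s) ?N" and ?E' = "ideal_sum ((*) (x ^ Suc t) ` prev M s) ?N"
  have idM: "is_ideal (M s)" and idN: "is_ideal ?N" using graded_genD[OF gg] by blast+
  have idE': "is_ideal ?E'" using idN by (intro is_ideal_sum is_ideal_image is_ideal_prev)
  have pM: "x ^ t * a \<in> M (s + t)" if "a \<in> M s" for a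
    using that
  proof (induction t)
    case (Suc t)
    then show ?case using graded_genD(4)[OF gg, of x "x ^ t * a" "s + t"] by (simp add: mult.assoc)
  qed simp
  have E_M: "?E \<subseteq> M (s + t)"
    using graded_genD(1,3)[OF gg] pM by (intro ideal_sum_least) auto
  have E'_E: "?E' \<subseteq> ?E"
  proof (rule ideal_sum_mono)
    show "(*) (x ^ Suc t) ` prev M s \<subseteq> (*) (x ^ t) ` M s"
    proof clarify
      fix a assume "a \<in> prev M s"
      then have "x * a \<in> M s" using mult_prev by simp
      then show "x ^ Suc t * a \<in> (*) (x ^ t) ` M s" by (intro image_eqI[of _ _ "x * a"]) (simp_all add: mult.left_commute mult.assoc)
    qed
  qed simp
  have idE: "is_ideal ?E" using idM idN by (intro is_ideal_sum is_ideal_image)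
  have "fin_len ?E ?N"
    by (rule fin_len_lower[OF fl idE ideal_sum_upper2[OF is_ideal_image[OF idM]] E_M])
  then have "qlength ?E ?N = qlength ?E ?E' + qlength ?E' ?N"
    using idE' ideal_sum_upper2[OF is_ideal_image[OF is_ideal_prev]] E'_E by (rule qlength_split)
  moreover have "?E = ideal_sum ((*) (x ^ t) ` M s) ?E'"
    by (intro equalityI ideal_sum_least ideal_sum_mono subset_refl idE E'_E ideal_sum_upper1 idN
        is_ideal_sum is_ideal_image idM is_ideal_prev
        ideal_sum_upper2[OF is_ideal_image[OF is_ideal_prev]])
  moreover have "colon ?E' (M s) (x ^ t) = slice x M N t s"
  proof (intro equalityI subsetI)
    fix r assume "r \<in> colon ?E' (M s) (x ^ t)"
    then have r: "r \<in> M s" "x ^ t * r \<in> ?E'" by (simp_all add: colon_def)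
    then obtain a b where ab: "x ^ t * r = x ^ Suc t * a + b" "a \<in> prev M s" "b \<in> ?N"
      by (auto elim!: ideal_sumE)
    have "x ^ t * (r - x * a) = b" using ab(1) by (simp add: algebra_simps)
    moreover have "r - x * a \<in> M s" using r(1) mult_prev[of x a s] ab(2) ideal_diff[OF idM] by simp
    ultimately have "x * a + (r - x * a) \<in> slice x M N t s" using ab by (intro sliceI) simp_all
    then show "r \<in> slice x M N t s" by simp
  next
    fix r assume rs: "r \<in> slice x M N t s"
    then obtain a c where r: "r = x * a + c" "a \<in> prev M s" "x ^ t * c \<in> ?N" by (metis sliceE)
    have "x ^ Suc t * a + x ^ t * c \<in> ?E'" using r by (intro ideal_sumI) simp_all
    then show "r \<in> colon ?E' (M s) (x ^ t)"
      using rs slice_subset r(1) by (auto simp: colon_def algebra_simps)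
  qed
  ultimately show "qlength ?E ?N = qlength (M s) (slice x M N t s) + qlength ?E' ?N"
    using qlength_mult[OF idM idE', of "x ^ t"] by simp
qed

end

lemma slice_mono_N: "(\<And>n. N n \<subseteq> N' n) \<Longrightarrow> slice x M N t s \<subseteq> slice x M N' t s"
  unfolding slice_def by (intro ideal_sum_mono subset_refl) (auto simp: colon_def)

text \<open>Hilbert's basis theorem: the slices increase both in \<open>j\<close> and in \<open>t\<close>, so the diagonal \<open>t = j\<close> and
  the finitely many chains with smaller \<open>t\<close> control all of them.\<close>
lemma graded_ascending_chain:
  fixes M :: "nat \<Rightarrow> 'a::comm_ring_1 set" and N :: "nat \<Rightarrow> nat \<Rightarrow> 'a set"
  assumes noeth: "noetherian_ring TYPE('a)"
    and "\<And>j. graded_gen xs M (N j)" "\<And>j n. N j n \<subseteq> N (Suc j) n"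
  shows "\<exists>j0. \<forall>j n. N j n \<subseteq> N j0 n"
  using assms(2,3)
proof (induction xs arbitrary: N)
  case Nil
  have mono: "N i n \<subseteq> N j n" if "i \<le> j" for i j n
    using that by (induction j rule: dec_induct) (use Nil.prems(2) in blast)+
  have "\<exists>K. \<forall>j\<ge>K. N j 0 = N K 0"
    using noetherian_stable[OF noeth, of "\<lambda>j. N j 0"] Nil.prems(2) graded_genD(2)[OF Nil.prems(1)] by blast
  then obtain K where K: "\<And>j. j \<ge> K \<Longrightarrow> N j 0 = N K 0" by blast
  have "N j n \<subseteq> N K n" for j n
  proof (cases n)
    case 0
    have "N j 0 \<subseteq> N (max j K) 0" by (rule mono) simp
    also have "\<dots> = N K 0" by (rule K) simp
    finally show ?thesis using 0 by simp
  next
    case (Suc n')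
    have "N j n \<subseteq> M n" using graded_genD(3)[OF Nil.prems(1)] .
    also have "\<dots> \<subseteq> N K n" using graded_genD(6)[OF Nil.prems(1), of n' K] Suc by simp
    finally show ?thesis .
  qed
  then show ?case by blast
next
  case (Cons x xs)
  have mono: "N i n \<subseteq> N j n" if "i \<le> j" for i j n
    using that by (induction j rule: dec_induct) (use Cons.prems(2) in blast)+
  let ?E = "\<lambda>j. slice x M (N j)"
  have E_mono: "?E i t s \<subseteq> ?E j t' s" if "i \<le> j" "t \<le> t'" for i j t t' s
    using slice_mono_N[of "N i" "N j", OF mono[OF that(1)]] slice_mono[OF Cons.prems(1) that(2)] by blast
  have gE: "graded_gen xs M (?E j t)" for j t by (rule graded_gen_slice[OF Cons.prems(1)])
  have "\<exists>j0. \<forall>j s. ?E j j s \<subseteq> ?E j0 j0 s"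
    by (rule Cons.IH[of "\<lambda>j. ?E j j"]) (use gE E_mono in simp_all)
  then obtain j0 where j0: "\<And>j s. ?E j j s \<subseteq> ?E j0 j0 s" by blast
  have "\<exists>i. \<forall>j s. ?E j t s \<subseteq> ?E i t s" for t
    by (rule Cons.IH[of "\<lambda>j. ?E j t"]) (use gE E_mono in simp_all)
  then obtain J where J: "\<And>t j s. ?E j t s \<subseteq> ?E (J t) t s" by metis
  define j1 where "j1 = Max (insert j0 (J ` {..<j0}))"
  have j1: "j0 \<le> j1" "\<And>t. t < j0 \<Longrightarrow> J t \<le> j1" unfolding j1_def by (auto intro: Max_ge)
  have E_le: "?E j t s \<subseteq> ?E j1 t s" for j t s
  proof (cases "t < j0")
    case True
    then show ?thesis using J[of j t s] E_mono[of "J t" j1 t t s] j1(2) by auto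
  next
    case False
    have "?E j t s \<subseteq> ?E (max j t) (max j t) s" by (rule E_mono) simp_all
    also have "\<dots> \<subseteq> ?E j0 j0 s" by (rule j0)
    also have "\<dots> \<subseteq> ?E j1 t s" by (rule E_mono) (use False j1 in simp_all)
    finally show ?thesis .
  qed
  have "N j n \<subseteq> N j1 n" for j n
  proof (cases "j \<le> j1")
    case False
    then have "j1 \<le> j" by simp
    show ?thesis
      by (rule slice_reflects[OF Cons.prems(1)])
        (rule mono[OF \<open>j1 \<le> j\<close>] graded_genD(3)[OF Cons.prems(1)] graded_genD(2)[OF Cons.prems(1)] E_le)+
  qed (rule mono)
  then show ?case by blast
qed

text \<open>\<open>Q t\<close> is the Hilbert function of \<open>x^t(M/N)\<close>, regraded to start
  in degree 0, and its recursion peels off one slice, which has one variable fewer. From some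
  \<open>T\<close> on the slices are constant, so \<open>Q T\<close> consists of partial sums of a
  single slice function, at the cost of one degree; finitely many steps lead back from
  \<open>T\<close> to 0.\<close>

theorem hilbert_function_num_poly:
  fixes M N :: "nat \<Rightarrow> 'a::comm_ring_1 set"
  assumes noeth: "noetherian_ring TYPE('a)"
    and "graded_gen xs M N" "\<And>n. fin_len (M n) (N n)"
  shows "num_poly (length xs) (\<lambda>n. int (qlength (M n) (N n)))"
  using assms(2,3)
proof (induction xs arbitrary: N)
  case Nil
  have "qlength (M n) (N n) = 0" if n: "n \<ge> 1" for n
  proof -
    obtain k where "n = Suc k" using n by (cases n) auto
    then have "M n = N n" using graded_genD(3,6)[OF Nil.prems(1)] by (intro equalityI) simp_all
    then show ?thesis using graded_genD(1)[OF Nil.prems(1)] by (metis qlength_refl)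
  qed
  then show ?case unfolding num_poly_def by (intro exI[of _ 1]) simp
next
  case (Cons x xs)
  note gg = Cons.prems(1)
  let ?h = "\<lambda>t s. int (qlength (M s) (slice x M N t s))"
  define Q where "Q t s = int (qlength (ideal_sum ((*) (x ^ t) ` M s) (N (s + t))) (N (s + t)))" for t s
  have h: "num_poly (length xs) (?h t)" for t
    using Cons.IH[OF graded_gen_slice[OF gg] fin_len_slice[OF gg Cons.prems(2)]] .
  have Q_rec: "Q t = (\<lambda>s. ?h t s + sh (Q (Suc t)) s)" for t
  proof
    fix s
    show "Q t s = ?h t s + sh (Q (Suc t)) s"
      using qlength_slice_step[OF gg Cons.prems(2), of t s] graded_genD(2)[OF gg, of t]
      by (cases s) (simp_all add: Q_def qlength_refl)
  qed
  have "\<exists>T. \<forall>t s. slice x M N t s \<subseteq> slice x M N T s"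
    by (rule graded_ascending_chain[OF noeth graded_gen_slice[OF gg]]) (rule slice_step[OF gg])
  then obtain T where T: "\<And>t s. slice x M N t s \<subseteq> slice x M N T s" by blast
  have hT: "?h t = ?h T" if "t \<ge> T" for t
    using T slice_mono[OF gg that] by (intro ext) (metis subset_antisym)
  \<comment> \<open>The recursion raises \<open>t\<close> while it lowers \<open>s\<close>, and from
    \<open>T\<close> on every term is the same \<open>?h T\<close>.\<close>
  have "Q t s = (\<Sum>i\<le>s. ?h T i)" if "t \<ge> T" for t s
    using that
  proof (induction s arbitrary: t)
    case 0
    then show ?case using fun_cong[OF Q_rec[of t], of 0] fun_cong[OF hT[of t], of 0] by simp
  next
    case (Suc s)
    then show ?case using fun_cong[OF Q_rec[of t], of "Suc s"] fun_cong[OF hT[of t], of "Suc s"] by simp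
  qed
  then have "Q T = (\<lambda>s. \<Sum>i\<le>s. ?h T i)" by auto
  then have base: "num_poly (Suc (length xs)) (Q T)" using num_poly_partial_sums[OF h] by simp
  have "num_poly (Suc (length xs)) (Q t)" if "t \<le> T" for t
    using that
  proof (induction t rule: inc_induct)
    case (step t)
    then show ?case
      using num_poly_add[OF num_poly_Suc[OF h[of t]] num_poly_sh[OF step.IH]] Q_rec[of t] by simp
  qed (rule base)
  then have "num_poly (Suc (length xs)) (Q 0)" by simp
  moreover have "Q 0 = (\<lambda>n. int (qlength (M n) (N n)))"
  proof
    fix n
    have "ideal_sum ((*) 1 ` M n) (N n) = M n"
      using graded_genD(1-3)[OF gg]
      by (simp add: equalityI ideal_sum_least ideal_sum_upper1)
    then show "Q 0 n = int (qlength (M n) (N n))" by (simp add: Q_def)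
  qed
  ultimately show ?case by simp
qed

subsection \<open>Multiplicity\<close>

lemma is_ideal_prod: "is_ideal (ideal_prod A B)"
  by (simp add: ideal_prod_def is_ideal_gen_ideal)

lemma ideal_prodI: "a \<in> A \<Longrightarrow> b \<in> B \<Longrightarrow> a * b \<in> ideal_prod A B"
  unfolding ideal_prod_def by (rule gen_ideal_upper[THEN subsetD]) blast

lemma ideal_prod_least:
  "is_ideal C \<Longrightarrow> (\<And>a b. a \<in> A \<Longrightarrow> b \<in> B \<Longrightarrow> a * b \<in> C) \<Longrightarrow> ideal_prod A B \<subseteq> C"
  unfolding ideal_prod_def by (rule gen_ideal_least) auto

lemma ideal_prod_mono: "A \<subseteq> A' \<Longrightarrow> B \<subseteq> B' \<Longrightarrow> ideal_prod A B \<subseteq> ideal_prod A' B'"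
  by (intro ideal_prod_least is_ideal_prod ideal_prodI) auto

lemma ideal_prod_subset1: "is_ideal A \<Longrightarrow> ideal_prod A B \<subseteq> A"
  and ideal_prod_subset2: "is_ideal B \<Longrightarrow> ideal_prod A B \<subseteq> B"
  by (rule ideal_prod_least; simp add: ideal_mult ideal_mult_right)+

lemma ideal_prod_left_commute: "ideal_prod A (ideal_prod B C) = ideal_prod B (ideal_prod A C)"
proof -
  have "ideal_prod A (ideal_prod B C) \<subseteq> ideal_prod B (ideal_prod A C)" for A B
  proof (rule ideal_prod_least[OF is_ideal_prod])
    fix a u assume a: "a \<in> A" and u: "u \<in> ideal_prod B C"
    have "ideal_prod B C \<subseteq> colon (ideal_prod B (ideal_prod A C)) UNIV a"
    proof (rule ideal_prod_least)
      fix b c assume "b \<in> B" "c \<in> C"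
      then have "b * (a * c) \<in> ideal_prod B (ideal_prod A C)" using a by (intro ideal_prodI)
      then show "b * c \<in> colon (ideal_prod B (ideal_prod A C)) UNIV a"
        by (simp add: colon_def mult.left_commute)
    qed (intro is_ideal_colon is_ideal_prod is_ideal_UNIV)
    then show "a * u \<in> ideal_prod B (ideal_prod A C)" using u by (auto simp: colon_def)
  qed
  then show ?thesis by blast
qed

lemma is_ideal_pow: "is_ideal (ideal_pow I n)"
  by (cases n) (simp_all add: is_ideal_prod)

lemma ideal_pow_Suc_subset: "ideal_pow I (Suc n) \<subseteq> ideal_pow I n"
  using ideal_prod_subset2[OF is_ideal_pow] by simp

lemma ideal_pow_mono: "J \<subseteq> I \<Longrightarrow> ideal_pow J n \<subseteq> ideal_pow I n"
  by (induction n) (simp_all add: ideal_prod_mono)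

lemma radical_mono: "A \<subseteq> B \<Longrightarrow> radical A \<subseteq> radical B"
  by (auto simp: radical_def)

lemma radical_ideal_pow: "radical I \<subseteq> radical (ideal_pow I n)"
proof
  fix x assume "x \<in> radical I"
  then obtain k where k: "x ^ k \<in> I" by (auto simp: radical_def)
  have "x ^ (k * n) \<in> ideal_pow I n"
    by (induction n) (simp_all add: power_add ideal_prodI[OF k])
  then show "x \<in> radical (ideal_pow I n)" by (auto simp: radical_def)
qed

lemma reduction_pow:
  assumes "ideal_prod J (ideal_pow I r) = ideal_pow I (Suc r)"
  shows "ideal_prod J (ideal_pow I (r + n)) = ideal_pow I (Suc (r + n))"
proof (induction n)
  case (Suc n)
  have "ideal_prod J (ideal_pow I (r + Suc n)) = ideal_prod I (ideal_prod J (ideal_pow I (r + n)))"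
    by (simp add: ideal_prod_left_commute)
  then show ?case using Suc by simp
qed (use assms in simp)

lemma reduction_pow_subset:
  assumes "ideal_prod J (ideal_pow I r) = ideal_pow I (Suc r)"
  shows "ideal_pow I (r + n) \<subseteq> ideal_pow J n"
proof (induction n)
  case (Suc n)
  then show ?case using reduction_pow[OF assms, of n] ideal_prod_mono[OF subset_refl Suc, of J]
    by (simp del: ideal_pow.simps(2) add: ideal_pow.simps(2)[of J])
qed simp

lemma qlength_UNIV_antimono:
  "fin_len UNIV A \<Longrightarrow> is_ideal B \<Longrightarrow> A \<subseteq> B \<Longrightarrow> qlength UNIV B \<le> qlength UNIV A"
  using qlength_split[of UNIV A B] by simp

text \<open>The bound \<open>n \<ge> d\<close> ensures that the zero convention at negative
  arguments is never reached.\<close>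

lemma nab_pow_translate: "n \<ge> d \<Longrightarrow> (nab ^^ d) (\<lambda>n. g (n + s)) n = (nab ^^ d) g (n + s)"
proof (induction d arbitrary: n)
  case (Suc d)
  then obtain k where "n = Suc k" "k \<ge> d" by (metis Suc_le_D Suc_le_mono)
  then show ?case using Suc.IH[of k] Suc.IH[of n] by simp
qed simp

lemma nab_pow_of_int: "(nab ^^ d) (\<lambda>n. real_of_int (g n)) = (\<lambda>n. real_of_int ((nab ^^ d) g n))"
proof (induction d)
  case (Suc d)
  show ?case
  proof
    show "(nab ^^ Suc d) (\<lambda>n. real_of_int (g n)) n = real_of_int ((nab ^^ Suc d) g n)" for n
      by (cases n) (simp_all add: Suc)
  qed
qed simp

lemma qlength_standard_nab:
  assumes "F 0 = UNIV" "\<And>k. is_ideal (F k)" "\<And>k. fin_len UNIV (F k)"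
    and "\<And>x k a. x \<in> set xs \<Longrightarrow> a \<in> F k \<Longrightarrow> x * a \<in> F (Suc k)"
    and "rev_regular xs" "standard xs F n" "k \<le> n"
  shows "fin_len (lin_comb xs UNIV) (lin_comb xs (F k))"
    and "int (qlength (lin_comb xs UNIV) (lin_comb xs (F k)))
      = int (qlength UNIV (F (Suc k))) - (nab ^^ length xs) (\<lambda>k. int (qlength UNIV (F k))) (Suc k)"
  using qlength_standard_product[OF assms] by (simp_all add: sum_nab_pow)

context noeth_local
begin

lemma nab_qlength_powers:
  assumes J: "J = gen_ideal (set xs)" and "rev_regular xs" "m \<subseteq> radical J"
  shows "(nab ^^ length xs) (\<lambda>k. int (qlength UNIV (ideal_pow J k))) (Suc k) = int (qlength UNIV J)"
proof -
  have fl: "fin_len UNIV (ideal_pow J k)" for k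
    using assms(3) radical_ideal_pow[of J k] by (intro fin_len_if_radical is_ideal_pow) blast
  have lc: "lin_comb xs (ideal_pow J k) = ideal_pow J (Suc k)" for k
    unfolding J using ideal_prod_gen_ideal[OF is_ideal_pow, of xs "gen_ideal (set xs)" k] by simp
  have lcU: "lin_comb xs UNIV = J" by (simp add: J gen_ideal_eq_lin_comb)
  \<comment> \<open>The \<open>J\<close>-adic filtration is standard in every degree because
    \<open>J J^k = J^(k+1)\<close>.\<close>
  have "standard xs (ideal_pow J) k" unfolding standard_def lc by blast
  moreover have "x * a \<in> ideal_pow J (Suc k)" if "x \<in> set xs" "a \<in> ideal_pow J k" for x a k
    using that gen_ideal_upper[of "set xs"] J by (auto intro: ideal_prodI)
  ultimately have *: "int (qlength J (ideal_pow J (Suc k)))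
      = int (qlength UNIV (ideal_pow J (Suc k)))
        - (nab ^^ length xs) (\<lambda>k. int (qlength UNIV (ideal_pow J k))) (Suc k)"
    using qlength_standard_nab(2)[of "ideal_pow J" xs k k, OF _ is_ideal_pow fl _ assms(2)]
    unfolding lc lcU by simp
  have idJ: "is_ideal J" by (simp add: J is_ideal_gen_ideal)
  then have "ideal_pow J (Suc k) \<subseteq> J" by (simp add: ideal_prod_subset1)
  then have "qlength UNIV (ideal_pow J (Suc k)) = qlength UNIV J + qlength J (ideal_pow J (Suc k))"
    using fl idJ subset_UNIV by (intro qlength_split)
  then show ?thesis using * by simp
qed

theorem hs_mult_eq_qlength:
  assumes J: "J = gen_ideal (set xs)" and reg: "rev_regular xs" and "J \<subseteq> I" and "m \<subseteq> radical J"
    and red: "ideal_prod J (ideal_pow I r) = ideal_pow I (Suc r)"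
  shows "hs_mult I (length xs) = int (qlength UNIV J)"
proof -
  let ?d = "length xs"
  let ?p = "\<lambda>n. int (qlength UNIV (ideal_pow I n))" and ?q = "\<lambda>n. int (qlength UNIV (ideal_pow J n))"
  have flJ: "fin_len UNIV (ideal_pow J k)" for k
    using assms(4) radical_ideal_pow[of J k] by (intro fin_len_if_radical is_ideal_pow) blast
  have flI: "fin_len UNIV (ideal_pow I k)" for k
    by (rule fin_len_UNIV_mono[OF flJ is_ideal_pow ideal_pow_mono[OF \<open>J \<subseteq> I\<close>]])
  \<comment> \<open>Starting at \<open>I^r\<close>, the reduction equation makes the module
    generated in degree 0 by the \<open>d\<close> generators of \<open>J\<close>, so the degree
    bound is in terms of \<open>d\<close>.\<close>
  let ?M = "\<lambda>n. ideal_pow I (r + n)" and ?N = "\<lambda>n. ideal_pow I (Suc (r + n))"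
  have mult: "x * a \<in> ideal_pow I (Suc n)" if "x \<in> set xs" "a \<in> ideal_pow I n" for x a n
    using that gen_ideal_upper[of "set xs"] J \<open>J \<subseteq> I\<close> by (auto intro: ideal_prodI)
  have lc: "lin_comb xs (?M n) = ?M (Suc n)" for n
    using reduction_pow[OF red, of n] ideal_prod_gen_ideal[OF is_ideal_pow, of xs] J by simp
  have "graded_gen xs ?M ?N"
    unfolding graded_gen_def lc
    using mult[of _ _ "r + _"] mult[of _ _ "Suc (r + _)"] ideal_sum_upper1[OF is_ideal_pow, of _ I]
      is_ideal_pow[of I] ideal_pow_Suc_subset[of I]
    by (simp del: ideal_pow.simps)
  moreover have "fin_len (?M n) (?N n)" for n
    using flI is_ideal_pow ideal_pow_Suc_subset subset_UNIV by (rule fin_len_lower)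
  ultimately have H: "num_poly ?d (\<lambda>n. int (qlength (?M n) (?N n)))"
    by (rule hilbert_function_num_poly[OF noeth])
  \<comment> \<open>Index 0 is excluded because \<open>nab\<close> returns the whole value
    \<open>?p r\<close> there.\<close>
  have "nab (\<lambda>n. ?p (n + r)) n = sh (\<lambda>n. int (qlength (?M n) (?N n))) n" if n: "n \<ge> 1" for n
  proof -
    obtain k where k: "n = Suc k" using n by (cases n) auto
    have "qlength UNIV (?N k) = qlength UNIV (?M k) + qlength (?M k) (?N k)"
      using flI is_ideal_pow ideal_pow_Suc_subset subset_UNIV by (rule qlength_split)
    then show ?thesis using k by (simp add: add.commute del: ideal_pow.simps)
  qed
  then have eq: "(nab ^^ ?d) (nab (\<lambda>n. ?p (n + r))) n = (nab ^^ ?d) (sh (\<lambda>n. int (qlength (?M n) (?N n)))) n"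
    if "n \<ge> 1 + ?d" for n
    by (rule nab_pow_cong[OF _ that])
  obtain K where K: "\<forall>n\<ge>K. (nab ^^ ?d) (sh (\<lambda>n. int (qlength (?M n) (?N n)))) n = 0"
    using num_poly_sh[OF H] by (auto simp: num_poly_def)
  have "(nab ^^ Suc ?d) (\<lambda>n. ?p (n + r)) n = 0" if "n \<ge> max K (1 + ?d)" for n
    using eq[of n] K that by (simp add: funpow_Suc_right del: funpow.simps)
  then have "num_poly (Suc ?d) (\<lambda>n. ?p (n + r))" unfolding num_poly_def by blast
  then obtain e N where e: "\<forall>n\<ge>N. (nab ^^ ?d) (\<lambda>n. ?p (n + r)) n = e"
    using num_poly_eventually_const by blast
  have e': "(nab ^^ ?d) ?p n = e" if "n \<ge> max N ?d + r" for n
    using e[rule_format, of "n - r"] nab_pow_translate[of ?d "n - r" ?p r] that by simp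
  have q: "(nab ^^ ?d) ?q n = int (qlength UNIV J)" if n: "n \<ge> 1" for n
  proof -
    obtain k where "n = Suc k" using n by (cases n) auto
    then show ?thesis using nab_qlength_powers[OF J reg \<open>m \<subseteq> radical J\<close>] by simp
  qed
  have "int (qlength UNIV J) - e \<ge> 0"
  proof (rule nab_limit_nonneg)
    show "\<forall>n\<ge>max 1 (max N ?d + r). (nab ^^ ?d) (\<lambda>n. ?q n - ?p n) n = int (qlength UNIV J) - e"
      unfolding nab_pow_diff using e' q by simp
    show "\<forall>n\<ge>0. 0 \<le> ?q n - ?p n"
      using qlength_UNIV_antimono[OF flJ is_ideal_pow ideal_pow_mono[OF \<open>J \<subseteq> I\<close>]] by simp
  qed
  moreover have "e - int (qlength UNIV J) \<ge> 0"
  proof (rule nab_limit_nonneg)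
    show "\<forall>n\<ge>max 1 N. (nab ^^ ?d) (\<lambda>n. ?p (n + r) - ?q n) n = e - int (qlength UNIV J)"
      unfolding nab_pow_diff using e q by simp
    show "\<forall>n\<ge>0. 0 \<le> ?p (n + r) - ?q n"
      using qlength_UNIV_antimono[OF flI is_ideal_pow reduction_pow_subset[OF red]]
      by (simp add: add.commute)
  qed
  ultimately have "e = int (qlength UNIV J)" by simp
  \<comment> \<open>\<open>hs_mult\<close> samples the lengths at \<open>I^(n+1)\<close>;
    translation by one leaves the eventual \<open>d\<close>-th difference unchanged.\<close>
  moreover have "(nab ^^ ?d) (\<lambda>n. ?p (Suc n)) n = e" if "n \<ge> max N ?d + r" for n
    using nab_pow_translate[of ?d n ?p 1] e'[of "n + 1"] that by simp
  then have "hs_mult I ?d = e"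
    unfolding hs_mult_def by (intro hs_coefficient[of "max N ?d + r"]) blast
  ultimately show ?thesis by simp
qed

lemma reduction_regular_generators:
  assumes ys: "regular_sequence m ys" "length ys = length xs"
    and "m \<subseteq> radical (gen_ideal (set xs))" "gen_ideal (set xs) \<subseteq> m"
  obtains zs where "length zs = length xs" "gen_ideal (set zs) = gen_ideal (set xs)" "rev_regular zs"
proof -
  have "regseq m ys {0}"
  proof (rule regseq_of_nth)
    fix i assume "i < length ys"
    then show "ys ! i \<in> m \<and> regular_on (adjoin_list (take i ys) {0}) (ys ! i)"
      using ys(1) unfolding regular_sequence_def regular_on_def adjoin_list_eq_gen_ideal
      by (auto dest: nth_mem)
  qed
  then obtain zs where "length zs = length xs" "gen_ideal (set zs) = gen_ideal (set xs)" "regseq m zs {0}"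
    using regseq_generators[OF is_ideal_zero, of ys xs] assms unfolding adjoin_list_eq_gen_ideal by blast
  then show ?thesis using that[of "rev zs"] rev_regular_if_regseq[of m zs] by simp
qed

end

section \<open>The length formula for standard filtrations\<close>

theorem theorem3p5:
  fixes m I J :: "'a::comm_ring_1 set" and F :: "int \<Rightarrow> 'a set" and d n :: nat
  assumes "cm_local_ring m d"
    and "infinite_residue_field m"
    and "m_primary m I"
    and "admissible_filtration I F"
    and "minimal_reduction d J I"
    and "\<forall>k::nat. 1 \<le> k \<and> k \<le> n \<longrightarrow> J \<inter> F (int k) = ideal_prod J (F (int k - 1))"
  shows "\<forall>k::nat. k \<le> n \<longrightarrow>
    real (qlength (F (int k + 1)) (ideal_prod J (F (int k)))) =
      real_of_int (hs_mult I d)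
      + (\<Sum>i=0..k. (-1) ^ (i + 1) * ((real d - 1) gchoose i)
                   * real (qlength (F (int (k - i))) (F (int (k - i) + 1))))"
proof (intro allI impI)
  fix k :: nat assume k: "k \<le> n"
  interpret noeth_local m using assms(1) by unfold_locales (simp add: cm_local_ring_def)
  obtain ys where ys: "length ys = d" "regular_sequence m ys"
    using assms(1) by (auto simp: cm_local_ring_def depth_eq_def)
  obtain xs r where xs: "length xs = d" "J = gen_ideal (set xs)" and JI: "J \<subseteq> I"
    and red: "ideal_prod J (ideal_pow I r) = ideal_pow I (Suc r)"
    using assms(5) by (auto simp: minimal_reduction_def)
  have idJ: "is_ideal J" using xs is_ideal_gen_ideal by simp
  have radI: "radical I = m" using assms(3) by (simp add: m_primary_def)
  have "I \<subseteq> radical I" unfolding radical_def using power_one_right by (metis (mono_tags) mem_Collect_eq subsetI)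
  then have "J \<subseteq> m" using JI radI by blast
  \<comment> \<open>A power of \<open>I\<close> inside \<open>J\<close> makes \<open>J\<close> as
    large as \<open>I\<close> up to radical, which finite length of \<open>R/J\<close>
    requires.\<close>
  have "ideal_pow I (Suc r) \<subseteq> J" using red ideal_prod_subset1[OF idJ] by metis
  then have radJ: "m \<subseteq> radical J" using radical_ideal_pow[of I "Suc r"] radical_mono radI by blast
  obtain zs where zs: "length zs = d" "J = gen_ideal (set zs)" "rev_regular zs"
    using reduction_regular_generators[OF ys(2), of xs] ys(1) xs radJ \<open>J \<subseteq> m\<close> by metis
  have mult: "hs_mult I d = int (qlength UNIV J)"
    using hs_mult_eq_qlength[OF zs(2,3) JI radJ red] zs(1) by simp
  define G where "G k = F (int k)" for k :: nat
  have idG: "is_ideal (G k)" and G0: "G 0 = UNIV" and GSuc: "G (Suc k) \<subseteq> G k"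
    and powG: "ideal_pow I k \<subseteq> G k" for k
  proof -
    have F: "\<forall>n. is_ideal (F n)" "\<forall>n. F (n + 1) \<subseteq> F n" "\<forall>n\<le>0. F n = UNIV"
      "\<forall>n\<ge>0. ideal_pow I (nat n) \<subseteq> F n"
      using assms(4) unfolding admissible_filtration_def by blast+
    show "is_ideal (G k)" "G 0 = UNIV" using F(1,3) by (simp_all add: G_def)
    show "G (Suc k) \<subseteq> G k" using F(2)[rule_format, of "int k"] by (simp add: G_def add.commute)
    show "ideal_pow I k \<subseteq> G k" using F(4)[rule_format, of "int k"] by (simp add: G_def)
  qed
  have multG: "x * a \<in> G (Suc k)" if x: "x \<in> J" and a: "a \<in> G k" for x a k
  proof -
    have "x * 1 \<in> ideal_prod I UNIV" using x JI by (intro ideal_prodI) auto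
    then have "x \<in> G 1" using powG[of 1] by auto
    then have "x * a \<in> ideal_prod (F 1) (F (int k))" using a by (intro ideal_prodI) (simp_all add: G_def)
    also have "\<dots> \<subseteq> F (1 + int k)" using assms(4) unfolding admissible_filtration_def by blast
    finally show ?thesis by (simp add: G_def)
  qed
  have flG: "fin_len UNIV (G k)" for k
    using radical_ideal_pow[of I k] radical_mono[OF powG[of k]] radI
    by (intro fin_len_if_radical idG) blast
  have lc: "lin_comb zs (G k) = ideal_prod J (G k)" for k
    using ideal_prod_gen_ideal[OF idG] zs(2) by simp
  have lcU: "lin_comb zs UNIV = J" by (simp add: zs(2) gen_ideal_eq_lin_comb)
  have "standard zs G n"
    unfolding standard_def lc lcU
  proof (intro allI impI)
    fix k assume "k < n"
    then show "J \<inter> G (Suc k) \<subseteq> ideal_prod J (G k)"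
      using assms(6)[rule_format, of "Suc k"] by (simp add: G_def)
  qed
  moreover have "x * a \<in> G (Suc k)" if "x \<in> set zs" "a \<in> G k" for x a k
    using multG that gen_ideal_upper[of "set zs"] zs(2) by blast
  ultimately have JG: "fin_len J (ideal_prod J (G k))"
    "int (qlength J (ideal_prod J (G k)))
      = int (qlength UNIV (G (Suc k))) - (nab ^^ d) (\<lambda>k. int (qlength UNIV (G k))) (Suc k)"
    using qlength_standard_nab[of G zs n k, OF G0 idG flG _ zs(3) _ k] unfolding lc lcU zs(1) by blast+
  have flJ: "fin_len UNIV J" by (rule fin_len_if_radical[OF idJ radJ])
  have fl: "fin_len UNIV (ideal_prod J (G k))" by (rule fin_len_trans[OF flJ JG(1)])
  \<comment> \<open>The length of \<open>R/(J I_k)\<close> is computed twice, through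
    \<open>I_(k+1)\<close> and through \<open>J\<close>; the term
    \<open>\<lambda>(R/I_(k+1))\<close> then cancels against the one in
    \<open>JG(2)\<close>.\<close>
  have "ideal_prod J (G k) \<subseteq> G (Suc k)" by (intro ideal_prod_least idG multG)
  then have "qlength UNIV (ideal_prod J (G k)) = qlength UNIV (G (Suc k)) + qlength (G (Suc k)) (ideal_prod J (G k))"
    using fl idG by (intro qlength_split) simp_all
  moreover have "qlength UNIV (ideal_prod J (G k)) = qlength UNIV J + qlength J (ideal_prod J (G k))"
    by (rule qlength_additive[OF flJ JG(1)])
  ultimately have main: "real (qlength (G (Suc k)) (ideal_prod J (G k)))
      = real_of_int (hs_mult I d) - real_of_int ((nab ^^ d) (\<lambda>k. int (qlength UNIV (G k))) (Suc k))"
    using JG(2) mult by linarith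
  have quot: "real (qlength UNIV (G (Suc j))) - real (qlength UNIV (G j)) = real (qlength (G j) (G (Suc j)))" for j
    using qlength_split[OF flG idG GSuc subset_UNIV, of j] by simp
  have "real_of_int ((nab ^^ d) (\<lambda>k. int (qlength UNIV (G k))) (Suc k))
    = (nab ^^ d) (\<lambda>k. real (qlength UNIV (G k))) (Suc k)"
    using fun_cong[OF nab_pow_of_int[of d "\<lambda>k. int (qlength UNIV (G k))"]] by simp
  \<comment> \<open>\<open>G 0 = UNIV\<close> makes the length function vanish at 0, and its
    increments are the \<open>\<lambda>_F(j)\<close> of the formula.\<close>
  also have "\<dots> = (\<Sum>i=0..k. (-1) ^ i * ((real d - 1) gchoose i) * real (qlength (G (k - i)) (G (Suc (k - i)))))"
    by (subst nab_pow_gbinomial) (simp_all add: G0 qlength_refl quot)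
  finally show "real (qlength (F (int k + 1)) (ideal_prod J (F (int k)))) =
      real_of_int (hs_mult I d)
      + (\<Sum>i=0..k. (-1) ^ (i + 1) * ((real d - 1) gchoose i)
                   * real (qlength (F (int (k - i))) (F (int (k - i) + 1))))"
    using main by (simp add: G_def add.commute sum_negf)
qed

end
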